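(* Let $\#$ be a parametrized monad on a category $\mathbf{C}$ with finite coproducts such that for every object $X$ a final coalgebra $\mathsf{out}_X:\Phi X\to X\#\Phi X$ of $X\#(-)$ exists. Then the category $\mathbf{C}^{\Phi}$ of Eilenberg–Moore algebras of the monad $\Phi$ and the category $\mathbf{CElg}_\#(\mathbf{C})$ of complete Elgot $\#$-algebras are isomorphic, via mutually inverse functors that are the identity on underlying morphisms and act on objects as follows: (a) a $\Phi$-algebra $(A,\chi:\Phi A\to A)$ is sent to the complete Elgot $\#$-algebra $(A,\ \chi\circ\mathsf{out}_A^{-1}\circ(\mathrm{id}_A\#\eta^\nu_A),\ (-)^\dagger)$ with $e^\dagger=\chi\circ\mathrm{coit}\,e$ for every $e:X\to A\#X$; (b) a complete Elgot $\#$-algebra $(A,a,(-)^\dagger)$ is sent to the $\Phi$-algebra $(A,\ \mathsf{out}_A^\dagger:\Phi A\to A)$.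
   Context: A parametrized monad is a bifunctor $\#:\mathbf{C}\times\mathbf{C}\to\mathbf{C}$ such that each $(-)\#X$ is a monad with unit $u^X_A:A\to A\#X$ and multiplication $m^X_A:(A\#X)\#X\to A\#X$, and for each $f:X\to Y$ the family $(\mathrm{id}_Z\#f)_Z$ is a monad morphism. $\mathrm{coit}\,e:X\to\Phi A$ is the unique coalgebra morphism from $(X,e:X\to A\#X)$ to $(\Phi A,\mathsf{out}_A)$. $\Phi$ is a monad with unit $\eta^\nu_X=\mathsf{out}_X^{-1}\circ u^{\Phi X}_X$ and Kleisli lifting: for $h:X\to\Phi Y$, $h^*$ is the unique morphism with $\mathsf{out}_Y\circ h^*=m^{\Phi Y}_Y\circ((\mathsf{out}_Y\circ h)\#h^* )\circ\mathsf{out}_X$; $\mu^\nu=\mathrm{id}^*$, $\Phi g=(\eta^\nu\circ g)^*$. A $\Phi$-algebra is $\chi:\Phi A\to A$ with $\chi\circ\eta^\nu_A=\mathrm{id}$, $\chi\circ\Phi\chi=\chi\circ\mu^\nu_A$. A $\#$-algebra is $(A,a)$ with $a:A\#A\to A$, $a\circ u^A_A=\mathrm{id}$, $a\circ(a\#\mathrm{id})=a\circ m^A_A$. A complete Elgot $\#$-algebra is a $\#$-algebra $(A,a)$ with an operator sending each $e:X\to A\#X$ to $e^\dagger:X\to A$ such that: (solution) $e^\dagger=a\circ(\mathrm{id}_A\#e^\dagger)\circ e$; (functoriality) for $e:X\to A\#X$, $f:Y\to A\#Y$, $h:X\to Y$, if $f\circ h=(\mathrm{id}_A\#h)\circ e$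 then $f^\dagger\circ h=e^\dagger$; (compositionality) for $f:Y\to A\#Y$, $g:X\to Y\#X$, with $f^\dagger\bullet g=(f^\dagger\#\mathrm{id}_X)\circ g$ and $f\blacksquare g=m^{Y+X}_A\circ(((\mathrm{id}_A\#\mathsf{inl})\circ f)\#\mathsf{inr})\circ[u^X_Y,g]$, one has $(f\blacksquare g)^\dagger\circ\mathsf{inr}=(f^\dagger\bullet g)^\dagger$. Morphisms $(A,a,\dagger)\to(B,b,\ddagger)$ in $\mathbf{CElg}_\#(\mathbf{C})$ are $f:A\to B$ with $((f\#\mathrm{id}_X)\circ e)^\ddagger=f\circ e^\dagger$ for all $e:X\to A\#X$. *)

theory Defs
  imports "HOL-Library.FuncSet"
begin

section \<open>Categories, functors and monads\<close>

record ('o, 'm) precat =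
  Ob :: "'o set"
  Ar :: "'m set"
  Dom :: "'m \<Rightarrow> 'o"
  Cod :: "'m \<Rightarrow> 'o"
  Id :: "'o \<Rightarrow> 'm"
  Comp :: "'m \<Rightarrow> 'm \<Rightarrow> 'm" (infixr "\<cdot>\<index>" 55)

definition hom :: "('o, 'm) precat \<Rightarrow> 'o \<Rightarrow> 'o \<Rightarrow> 'm set" where
  "hom C X Y = {f \<in> Ar C. Dom C f = X \<and> Cod C f = Y}"

locale category =
  fixes C :: "('o, 'm) precat" (structure)
  assumes Dom_in_Ob: "f \<in> Ar C \<Longrightarrow> Dom C f \<in> Ob C"
    and Cod_in_Ob: "f \<in> Ar C \<Longrightarrow> Cod C f \<in> Ob C"
    and Id_in_hom: "X \<in> Ob C \<Longrightarrow> Id C X \<in> hom C X X"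
    and Comp_in_hom: "\<lbrakk>f \<in> hom C X Y; g \<in> hom C Y Z\<rbrakk> \<Longrightarrow> g \<cdot> f \<in> hom C X Z"
    and Id_left: "f \<in> hom C X Y \<Longrightarrow> Id C Y \<cdot> f = f"
    and Id_right: "f \<in> hom C X Y \<Longrightarrow> f \<cdot> Id C X = f"
    and Comp_assoc: "\<lbrakk>f \<in> hom C W X; g \<in> hom C X Y; h \<in> hom C Y Z\<rbrakk>
      \<Longrightarrow> h \<cdot> (g \<cdot> f) = (h \<cdot> g) \<cdot> f"

definition inverse_ar :: "('o, 'm) precat \<Rightarrow> 'm \<Rightarrow> 'm" where
  "inverse_ar C f = (THE g. g \<in> hom C (Cod C f) (Dom C f) \<and>
     g \<cdot>\<^bsub>C\<^esub> f = Id C (Dom C f) \<and> f \<cdot>\<^bsub>C\<^esub> g = Id C (Cod C f))"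

definition product_category ::
    "('o, 'm) precat \<Rightarrow> ('p, 'n) precat \<Rightarrow> ('o \<times> 'p, 'm \<times> 'n) precat" where
  "product_category C D =
     \<lparr>Ob = Ob C \<times> Ob D, Ar = Ar C \<times> Ar D,
      Dom = (\<lambda>(f, g). (Dom C f, Dom D g)), Cod = (\<lambda>(f, g). (Cod C f, Cod D g)),
      Id = (\<lambda>(X, Y). (Id C X, Id D Y)),
      Comp = (\<lambda>(f', g') (f, g). (f' \<cdot>\<^bsub>C\<^esub> f, g' \<cdot>\<^bsub>D\<^esub> g))\<rparr>"

record ('o, 'm, 'p, 'n) functor_data =
  FOb :: "'o \<Rightarrow> 'p"
  FAr :: "'m \<Rightarrow> 'n"

locale cat_functor = src: category C + tgt: category D
  for C :: "('o, 'm) precat" and D :: "('p, 'n) precat" +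
  fixes F :: "('o, 'm, 'p, 'n) functor_data"
  assumes FOb_in_Ob: "X \<in> Ob C \<Longrightarrow> FOb F X \<in> Ob D"
    and FAr_in_hom: "f \<in> hom C X Y \<Longrightarrow> FAr F f \<in> hom D (FOb F X) (FOb F Y)"
    and FAr_Id: "X \<in> Ob C \<Longrightarrow> FAr F (Id C X) = Id D (FOb F X)"
    and FAr_Comp: "\<lbrakk>f \<in> hom C X Y; g \<in> hom C Y Z\<rbrakk>
      \<Longrightarrow> FAr F (g \<cdot>\<^bsub>C\<^esub> f) = FAr F g \<cdot>\<^bsub>D\<^esub> FAr F f"

definition inverse_functors ::
    "('o, 'm) precat \<Rightarrow> ('p, 'n) precat \<Rightarrow> ('o, 'm, 'p, 'n) functor_data
      \<Rightarrow> ('p, 'n, 'o, 'm) functor_data \<Rightarrow> bool" where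
  "inverse_functors C D F G \<longleftrightarrow>
     cat_functor C D F \<and> cat_functor D C G \<and>
     (\<forall>X \<in> Ob C. FOb G (FOb F X) = X) \<and> (\<forall>f \<in> Ar C. FAr G (FAr F f) = f) \<and>
     (\<forall>Y \<in> Ob D. FOb F (FOb G Y) = Y) \<and> (\<forall>g \<in> Ar D. FAr F (FAr G g) = g)"

definition identity_functor :: "('o, 'm, 'o, 'm) functor_data" where
  "identity_functor = \<lparr>FOb = (\<lambda>X. X), FAr = (\<lambda>f. f)\<rparr>"

definition comp_functor ::
    "('p, 'n, 'q, 'k) functor_data \<Rightarrow> ('o, 'm, 'p, 'n) functor_data
      \<Rightarrow> ('o, 'm, 'q, 'k) functor_data" where
  "comp_functor G F = \<lparr>FOb = (\<lambda>X. FOb G (FOb F X)), FAr = (\<lambda>f. FAr G (FAr F f))\<rparr>"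

definition nat_trans ::
    "('o, 'm) precat \<Rightarrow> ('p, 'n) precat \<Rightarrow> ('o, 'm, 'p, 'n) functor_data
      \<Rightarrow> ('o, 'm, 'p, 'n) functor_data \<Rightarrow> ('o \<Rightarrow> 'n) \<Rightarrow> bool" where
  "nat_trans C D F G \<alpha> \<longleftrightarrow>
     (\<forall>X \<in> Ob C. \<alpha> X \<in> hom D (FOb F X) (FOb G X)) \<and>
     (\<forall>X Y. \<forall>f \<in> hom C X Y. FAr G f \<cdot>\<^bsub>D\<^esub> \<alpha> X = \<alpha> Y \<cdot>\<^bsub>D\<^esub> FAr F f)"

record ('o, 'm) monad_data =
  MFun :: "('o, 'm, 'o, 'm) functor_data"
  Eta :: "'o \<Rightarrow> 'm"
  Mu :: "'o \<Rightarrow> 'm"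

locale cat_monad = category C
  for C :: "('o, 'm) precat" (structure) +
  fixes M :: "('o, 'm) monad_data"
  assumes MFun_functor: "cat_functor C C (MFun M)"
    and Eta_natural: "nat_trans C C identity_functor (MFun M) (Eta M)"
    and Mu_natural: "nat_trans C C (comp_functor (MFun M) (MFun M)) (MFun M) (Mu M)"
    and Mu_Eta: "X \<in> Ob C \<Longrightarrow> Mu M X \<cdot> Eta M (FOb (MFun M) X) = Id C (FOb (MFun M) X)"
    and Mu_FAr_Eta: "X \<in> Ob C \<Longrightarrow> Mu M X \<cdot> FAr (MFun M) (Eta M X) = Id C (FOb (MFun M) X)"
    and Mu_Mu: "X \<in> Ob C \<Longrightarrow> Mu M X \<cdot> Mu M (FOb (MFun M) X) = Mu M X \<cdot> FAr (MFun M) (Mu M X)"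

definition monad_morphism ::
    "('o, 'm) precat \<Rightarrow> ('o, 'm) monad_data \<Rightarrow> ('o, 'm) monad_data \<Rightarrow> ('o \<Rightarrow> 'm) \<Rightarrow> bool" where
  "monad_morphism C M N \<alpha> \<longleftrightarrow>
     nat_trans C C (MFun M) (MFun N) \<alpha> \<and>
     (\<forall>Z \<in> Ob C. \<alpha> Z \<cdot>\<^bsub>C\<^esub> Eta M Z = Eta N Z) \<and>
     (\<forall>Z \<in> Ob C. \<alpha> Z \<cdot>\<^bsub>C\<^esub> Mu M Z =
        Mu N Z \<cdot>\<^bsub>C\<^esub> (FAr (MFun N) (\<alpha> Z) \<cdot>\<^bsub>C\<^esub> \<alpha> (FOb (MFun M) Z)))"

text \<open>
  The category of objects of \<open>C\<close> with extra structure: \<open>U\<close> gives the underlying object, and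
  \<open>P x y f\<close> says that \<open>f\<close> preserves the structure. An arrow carries its source and target,
  so that different hom-sets are disjoint.
\<close>
definition structured_category ::
    "('o, 'm) precat \<Rightarrow> 's set \<Rightarrow> ('s \<Rightarrow> 'o) \<Rightarrow> ('s \<Rightarrow> 's \<Rightarrow> 'm \<Rightarrow> bool)
      \<Rightarrow> ('s, 's \<times> 's \<times> 'm) precat" where
  "structured_category C S U P =
     \<lparr>Ob = S,
      Ar = {(x, y, f). x \<in> S \<and> y \<in> S \<and> f \<in> hom C (U x) (U y) \<and> P x y f},
      Dom = (\<lambda>(x, y, f). x), Cod = (\<lambda>(x, y, f). y),
      Id = (\<lambda>x. (x, x, Id C (U x))),
      Comp = (\<lambda>(y', z, g) (x, y, f). (x, z, g \<cdot>\<^bsub>C\<^esub> f))\<rparr>"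

definition EM_algebra :: "('o, 'm) precat \<Rightarrow> ('o, 'm) monad_data \<Rightarrow> 'o \<Rightarrow> 'm \<Rightarrow> bool" where
  "EM_algebra C M A \<chi> \<longleftrightarrow>
     A \<in> Ob C \<and> \<chi> \<in> hom C (FOb (MFun M) A) A \<and>
     \<chi> \<cdot>\<^bsub>C\<^esub> Eta M A = Id C A \<and>
     \<chi> \<cdot>\<^bsub>C\<^esub> FAr (MFun M) \<chi> = \<chi> \<cdot>\<^bsub>C\<^esub> Mu M A"

definition EM_category ::
    "('o, 'm) precat \<Rightarrow> ('o, 'm) monad_data
      \<Rightarrow> ('o \<times> 'm, ('o \<times> 'm) \<times> ('o \<times> 'm) \<times> 'm) precat" where
  "EM_category C M =
     structured_category C {(A, \<chi>). EM_algebra C M A \<chi>} fst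
       (\<lambda>(A, \<chi>) (B, \<xi>) f. f \<cdot>\<^bsub>C\<^esub> \<chi> = \<xi> \<cdot>\<^bsub>C\<^esub> FAr (MFun M) f)"

definition coalgebra_morphism ::
    "('o, 'm) precat \<Rightarrow> ('o, 'm, 'o, 'm) functor_data \<Rightarrow> 'o \<Rightarrow> 'm \<Rightarrow> 'o \<Rightarrow> 'm \<Rightarrow> 'm \<Rightarrow> bool" where
  "coalgebra_morphism C F X e Y f h \<longleftrightarrow>
     h \<in> hom C X Y \<and> f \<cdot>\<^bsub>C\<^esub> h = FAr F h \<cdot>\<^bsub>C\<^esub> e"

definition final_coalgebra ::
    "('o, 'm) precat \<Rightarrow> ('o, 'm, 'o, 'm) functor_data \<Rightarrow> 'o \<Rightarrow> 'm \<Rightarrow> bool" where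
  "final_coalgebra C F Z z \<longleftrightarrow>
     Z \<in> Ob C \<and> z \<in> hom C Z (FOb F Z) \<and>
     (\<forall>X \<in> Ob C. \<forall>e \<in> hom C X (FOb F X). \<exists>!h. coalgebra_morphism C F X e Z z h)"

record ('o, 'm) coproduct_data =
  Cop :: "'o \<Rightarrow> 'o \<Rightarrow> 'o"
  Inl :: "'o \<Rightarrow> 'o \<Rightarrow> 'm"
  Inr :: "'o \<Rightarrow> 'o \<Rightarrow> 'm"

locale finite_coproducts = category C
  for C :: "('o, 'm) precat" (structure) +
  fixes K :: "('o, 'm) coproduct_data"
  assumes initial_object: "\<exists>I \<in> Ob C. \<forall>X \<in> Ob C. \<exists>!f. f \<in> hom C I X"
    and Cop_in_Ob: "\<lbrakk>X \<in> Ob C; Y \<in> Ob C\<rbrakk> \<Longrightarrow> Cop K X Y \<in> Ob C"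
    and Inl_in_hom: "\<lbrakk>X \<in> Ob C; Y \<in> Ob C\<rbrakk> \<Longrightarrow> Inl K X Y \<in> hom C X (Cop K X Y)"
    and Inr_in_hom: "\<lbrakk>X \<in> Ob C; Y \<in> Ob C\<rbrakk> \<Longrightarrow> Inr K X Y \<in> hom C Y (Cop K X Y)"
    and Cop_universal: "\<lbrakk>f \<in> hom C X Z; g \<in> hom C Y Z\<rbrakk>
      \<Longrightarrow> \<exists>!h. h \<in> hom C (Cop K X Y) Z \<and> h \<cdot> Inl K X Y = f \<and> h \<cdot> Inr K X Y = g"

definition copair :: "('o, 'm) precat \<Rightarrow> ('o, 'm) coproduct_data \<Rightarrow> 'm \<Rightarrow> 'm \<Rightarrow> 'm" where
  "copair C K f g = (THE h. h \<in> hom C (Cop K (Dom C f) (Dom C g)) (Cod C f) \<and>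
     h \<cdot>\<^bsub>C\<^esub> Inl K (Dom C f) (Dom C g) = f \<and>
     h \<cdot>\<^bsub>C\<^esub> Inr K (Dom C f) (Dom C g) = g)"


section \<open>Parametrized monads\<close>

text \<open>
  The bifunctor $\#$ is written \<open>\<sharp>\<close> on objects and \<open>\<otimes>\<close> on arrows;
  \<open>UnitP P X A\<close> is $u^X_A$ and \<open>MultP P X A\<close> is $m^X_A$.
\<close>

record ('o, 'm) pmonad_data =
  TOb :: "'o \<Rightarrow> 'o \<Rightarrow> 'o" (infixl "\<sharp>\<index>" 70)
  TAr :: "'m \<Rightarrow> 'm \<Rightarrow> 'm" (infixl "\<otimes>\<index>" 70)
  UnitP :: "'o \<Rightarrow> 'o \<Rightarrow> 'm"
  MultP :: "'o \<Rightarrow> 'o \<Rightarrow> 'm"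

definition bifunctor_of ::
    "('o, 'm) pmonad_data \<Rightarrow> ('o \<times> 'o, 'm \<times> 'm, 'o, 'm) functor_data" where
  "bifunctor_of P =
     \<lparr>FOb = (\<lambda>(A, X). A \<sharp>\<^bsub>P\<^esub> X), FAr = (\<lambda>(f, g). f \<otimes>\<^bsub>P\<^esub> g)\<rparr>"

definition monad_at :: "('o, 'm) precat \<Rightarrow> ('o, 'm) pmonad_data \<Rightarrow> 'o \<Rightarrow> ('o, 'm) monad_data" where
  "monad_at C P X =
     \<lparr>MFun = \<lparr>FOb = (\<lambda>A. A \<sharp>\<^bsub>P\<^esub> X), FAr = (\<lambda>f. f \<otimes>\<^bsub>P\<^esub> Id C X)\<rparr>,
      Eta = UnitP P X, Mu = MultP P X\<rparr>"

definition functor_at ::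
    "('o, 'm) precat \<Rightarrow> ('o, 'm) pmonad_data \<Rightarrow> 'o \<Rightarrow> ('o, 'm, 'o, 'm) functor_data" where
  "functor_at C P A = \<lparr>FOb = (\<lambda>X. A \<sharp>\<^bsub>P\<^esub> X), FAr = (\<lambda>f. Id C A \<otimes>\<^bsub>P\<^esub> f)\<rparr>"

locale parametrized_monad = category C
  for C :: "('o, 'm) precat" (structure) +
  fixes P :: "('o, 'm) pmonad_data"
  assumes bifunctor: "cat_functor (product_category C C) C (bifunctor_of P)"
    and monad_at: "X \<in> Ob C \<Longrightarrow> cat_monad C (monad_at C P X)"
    and monad_morphism_at: "f \<in> hom C X Y
      \<Longrightarrow> monad_morphism C (monad_at C P X) (monad_at C P Y) (\<lambda>Z. Id C Z \<otimes>\<^bsub>P\<^esub> f)"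


section \<open>The monad of final coalgebras and complete Elgot algebras\<close>

text \<open>
  The map \<open>TOb P\<close> need not be injective, so an arrow \<open>e\<close> from \<open>X\<close> to \<open>A \<sharp> X\<close> does not
  determine \<open>A\<close>, and similarly for \<open>\<Phi>\<close>. Operations depending on such an object
  take it as an argument.
\<close>

context
  fixes C :: "('o, 'm) precat" (structure)
    and P :: "('o, 'm) pmonad_data"
    and K :: "('o, 'm) coproduct_data"
    and \<Phi> :: "'o \<Rightarrow> 'o"
    and out :: "'o \<Rightarrow> 'm"
begin

definition coit :: "'o \<Rightarrow> 'm \<Rightarrow> 'm" where
  "coit A e = (THE h. coalgebra_morphism C (functor_at C P A) (Dom C e) e (\<Phi> A) (out A) h)"

definition nu_unit :: "'o \<Rightarrow> 'm" where
  "nu_unit X = inverse_ar C (out X) \<cdot> UnitP P (\<Phi> X) X"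

definition nu_lift :: "'o \<Rightarrow> 'o \<Rightarrow> 'm \<Rightarrow> 'm" where
  "nu_lift X Y h = (THE k. k \<in> hom C (\<Phi> X) (\<Phi> Y) \<and>
     out Y \<cdot> k = MultP P (\<Phi> Y) Y \<cdot> (((out Y \<cdot> h) \<otimes>\<^bsub>P\<^esub> k) \<cdot> out X))"

definition nu_monad :: "('o, 'm) monad_data" where
  "nu_monad =
     \<lparr>MFun = \<lparr>FOb = \<Phi>,
              FAr = (\<lambda>g. nu_lift (Dom C g) (Cod C g) (nu_unit (Cod C g) \<cdot> g))\<rparr>,
      Eta = nu_unit,
      Mu = (\<lambda>X. nu_lift (\<Phi> X) X (Id C (\<Phi> X)))\<rparr>"

definition sharp_algebra :: "'o \<Rightarrow> 'm \<Rightarrow> bool" where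
  "sharp_algebra A a \<longleftrightarrow>
     A \<in> Ob C \<and> a \<in> hom C (A \<sharp>\<^bsub>P\<^esub> A) A \<and>
     a \<cdot> UnitP P A A = Id C A \<and>
     a \<cdot> (a \<otimes>\<^bsub>P\<^esub> Id C A) = a \<cdot> MultP P A A"

definition equations :: "'o \<Rightarrow> 'm set" where
  "equations A = (\<Union>X \<in> Ob C. hom C X (A \<sharp>\<^bsub>P\<^esub> X))"

text \<open>For \<open>f \<in> hom C Y (A \<sharp> Y)\<close> and \<open>g \<in> hom C X (Y \<sharp> X)\<close>, this is $f \blacksquare g$.\<close>

definition equation_comp :: "'o \<Rightarrow> 'o \<Rightarrow> 'o \<Rightarrow> 'm \<Rightarrow> 'm \<Rightarrow> 'm" where
  "equation_comp A Y X f g =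
     MultP P (Cop K Y X) A \<cdot>
       ((((Id C A \<otimes>\<^bsub>P\<^esub> Inl K Y X) \<cdot> f) \<otimes>\<^bsub>P\<^esub> Inr K Y X) \<cdot>
          copair C K (UnitP P X Y) g)"

text \<open>
  The iteration operator is a HOL function made \<open>undefined\<close> outside its domain of
  definition, so that algebras with the same operator are equal as triples.
\<close>

definition complete_Elgot_algebra :: "'o \<Rightarrow> 'm \<Rightarrow> ('m \<Rightarrow> 'm) \<Rightarrow> bool" where
  "complete_Elgot_algebra A a d \<longleftrightarrow>
     sharp_algebra A a \<and>
     d \<in> extensional (equations A) \<and>
     (\<forall>X \<in> Ob C. \<forall>e \<in> hom C X (A \<sharp>\<^bsub>P\<^esub> X). d e \<in> hom C X A) \<and>
     (\<forall>X \<in> Ob C. \<forall>e \<in> hom C X (A \<sharp>\<^bsub>P\<^esub> X).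
        d e = a \<cdot> ((Id C A \<otimes>\<^bsub>P\<^esub> d e) \<cdot> e)) \<and>
     (\<forall>X \<in> Ob C. \<forall>Y \<in> Ob C.
        \<forall>e \<in> hom C X (A \<sharp>\<^bsub>P\<^esub> X). \<forall>f \<in> hom C Y (A \<sharp>\<^bsub>P\<^esub> Y). \<forall>h \<in> hom C X Y.
          f \<cdot> h = (Id C A \<otimes>\<^bsub>P\<^esub> h) \<cdot> e \<longrightarrow> d f \<cdot> h = d e) \<and>
     (\<forall>X \<in> Ob C. \<forall>Y \<in> Ob C.
        \<forall>f \<in> hom C Y (A \<sharp>\<^bsub>P\<^esub> Y). \<forall>g \<in> hom C X (Y \<sharp>\<^bsub>P\<^esub> X).
          d (equation_comp A Y X f g) \<cdot> Inr K Y X = d ((d f \<otimes>\<^bsub>P\<^esub> Id C X) \<cdot> g))"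

definition CElg_category ::
    "('o \<times> 'm \<times> ('m \<Rightarrow> 'm),
      ('o \<times> 'm \<times> ('m \<Rightarrow> 'm)) \<times> ('o \<times> 'm \<times> ('m \<Rightarrow> 'm)) \<times> 'm) precat" where
  "CElg_category =
     structured_category C {(A, a, d). complete_Elgot_algebra A a d} fst
       (\<lambda>(A, a, d) (B, b, d') f. \<forall>X \<in> Ob C. \<forall>e \<in> hom C X (A \<sharp>\<^bsub>P\<^esub> X).
          d' ((f \<otimes>\<^bsub>P\<^esub> Id C X) \<cdot> e) = f \<cdot> d e)"

definition EM_to_CElg_ob :: "'o \<times> 'm \<Rightarrow> 'o \<times> 'm \<times> ('m \<Rightarrow> 'm)" where
  "EM_to_CElg_ob = (\<lambda>(A, \<chi>).
     (A,
      \<chi> \<cdot> (inverse_ar C (out A) \<cdot> (Id C A \<otimes>\<^bsub>P\<^esub> nu_unit A)),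
      \<lambda>e \<in> equations A. \<chi> \<cdot> coit A e))"

definition CElg_to_EM_ob :: "'o \<times> 'm \<times> ('m \<Rightarrow> 'm) \<Rightarrow> 'o \<times> 'm" where
  "CElg_to_EM_ob = (\<lambda>(A, a, d). (A, d (out A)))"

end

definition over_identity ::
    "('s \<Rightarrow> 't) \<Rightarrow> ('s, 's \<times> 's \<times> 'm, 't, 't \<times> 't \<times> 'm) functor_data" where
  "over_identity F = \<lparr>FOb = F, FAr = (\<lambda>(x, y, f). (F x, F y, f))\<rparr>"

end

theory Submission
  imports Defs
begin

text \<open>
  Functoriality of the iteration operator along the coalgebra morphism \<open>coit A e\<close> gives
  \<open>d e = d (out A) \<cdot> coit A e\<close>, so a complete Elgot algebra is determined by \<open>\<chi> = d (out A)\<close>.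
  Under this correspondence compositionality becomes the associativity law of \<open>\<chi>\<close>, because
  \<open>coit A (f \<^bold>\<box> g) \<cdot> Inr\<close> is the Kleisli lifting of \<open>coit A f\<close> composed with \<open>coit Y g\<close>, where
  \<open>f \<^bold>\<box> g\<close> is \<open>equation_comp A Y X f g\<close>. Conversely, associativity evaluated at
  \<open>unit \<otimes> unit\<close> yields \<open>a \<cdot> (Id A \<otimes> \<chi>) = \<chi> \<cdot> out_inv A\<close> for the induced operation \<open>a\<close>, which is
  the solution law.
\<close>

section \<open>Categories with structure\<close>

text \<open>
  Equations are normalised by conditional rewriting; the rules are phrased with \<open>Ar\<close>, \<open>Dom\<close>
  and \<open>Cod\<close> rather than \<open>hom\<close> so that their side conditions contain no extra variables.
\<close>

lemma homD:
  assumes "f \<in> hom C X Y"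
  shows "f \<in> Ar C" "Dom C f = X" "Cod C f = Y"
  using assms by (auto simp: hom_def)

lemma homI: "\<lbrakk>f \<in> Ar C; Dom C f = X; Cod C f = Y\<rbrakk> \<Longrightarrow> f \<in> hom C X Y"
  by (simp add: hom_def)

lemma nat_transD:
  "\<lbrakk>nat_trans C D F G \<alpha>; f \<in> hom C X Y\<rbrakk> \<Longrightarrow> FAr G f \<cdot>\<^bsub>D\<^esub> \<alpha> X = \<alpha> Y \<cdot>\<^bsub>D\<^esub> FAr F f"
  by (simp add: nat_trans_def)

context category
begin

lemma hom_in_Ob:
  assumes "f \<in> hom C X Y"
  shows "X \<in> Ob C" "Y \<in> Ob C"
  using assms Dom_in_Ob Cod_in_Ob by (auto simp: hom_def)

lemma Id_simps [simp]:
  assumes "X \<in> Ob C"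
  shows "Id C X \<in> Ar C" "Dom C (Id C X) = X" "Cod C (Id C X) = X"
  using homD[OF Id_in_hom[OF assms]] by auto

lemma Comp_simps [simp]:
  assumes "f \<in> Ar C" "g \<in> Ar C" "Dom C g = Cod C f"
  shows "g \<cdot> f \<in> Ar C" "Dom C (g \<cdot> f) = Dom C f" "Cod C (g \<cdot> f) = Cod C g"
  using homD[OF Comp_in_hom[of f "Dom C f" "Cod C f" g "Cod C g"]] assms by (auto simp: hom_def)

lemma Id_Comp [simp]: "\<lbrakk>f \<in> Ar C; Cod C f = Y\<rbrakk> \<Longrightarrow> Id C Y \<cdot> f = f"
  by (rule Id_left) (simp add: hom_def)

lemma Comp_Id [simp]: "\<lbrakk>f \<in> Ar C; Dom C f = X\<rbrakk> \<Longrightarrow> f \<cdot> Id C X = f"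
  by (rule Id_right) (simp add: hom_def)

text \<open>Right-nested composites are the simp normal form. A rule for \<open>g \<cdot> f\<close>
  then misses \<open>g \<cdot> (f \<cdot> k)\<close>, hence the \<open>_tail\<close> companions
  below; where a rule has none, the pair is regrouped by hand before it is rewritten.\<close>

lemma Comp_assoc_Ar [simp]:
  "\<lbrakk>f \<in> Ar C; g \<in> Ar C; h \<in> Ar C; Dom C g = Cod C f; Dom C h = Cod C g\<rbrakk>
    \<Longrightarrow> (h \<cdot> g) \<cdot> f = h \<cdot> (g \<cdot> f)"
  by (rule Comp_assoc[symmetric]) (auto simp: hom_def)

text \<open>Two-sided inverses are unique, so exhibiting one evaluates the definite description in
  \<open>inverse_ar\<close>.\<close>

lemma inverse_ar_eqI:
  assumes "f \<in> hom C X Y" "g \<in> hom C Y X" "g \<cdot> f = Id C X" "f \<cdot> g = Id C Y"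
  shows "inverse_ar C f = g"
  unfolding inverse_ar_def
proof (rule the_equality)
  show "g \<in> hom C (Cod C f) (Dom C f) \<and> g \<cdot> f = Id C (Dom C f) \<and> f \<cdot> g = Id C (Cod C f)"
    using assms by (auto simp: hom_def)
next
  fix g'
  assume g': "g' \<in> hom C (Cod C f) (Dom C f) \<and> g' \<cdot> f = Id C (Dom C f) \<and> f \<cdot> g' = Id C (Cod C f)"
  note [simp] = homD[OF assms(1)] homD[OF assms(2)]
  have [simp]: "g' \<in> Ar C" "Dom C g' = Y" "Cod C g' = X"
    using g' by (auto simp: hom_def)
  have "g' = (g' \<cdot> f) \<cdot> g"
    using assms(4) by simp
  also have "\<dots> = g"
    using g' by (metis Id_left assms(2) homD(2)[OF assms(1)])
  finally show "g' = g" .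
qed

end

section \<open>Categories of structured objects over a base category\<close>

text \<open>Identities and composition come from \<open>C\<close>, so the category laws carry over;
  what remains is that \<open>Q\<close> holds of identities and is closed under composition.\<close>

lemma (in category) category_structured_category:
  assumes U: "\<And>x. x \<in> S \<Longrightarrow> U x \<in> Ob C"
    and Id: "\<And>x. x \<in> S \<Longrightarrow> Q x x (Id C (U x))"
    and Comp: "\<And>x y z f g. \<lbrakk>x \<in> S; y \<in> S; z \<in> S; f \<in> hom C (U x) (U y); g \<in> hom C (U y) (U z);
      Q x y f; Q y z g\<rbrakk> \<Longrightarrow> Q x z (g \<cdot> f)"
  shows "category (structured_category C S U Q)"
proof
  fix w x y z f g h
  show "\<lbrakk>f \<in> hom (structured_category C S U Q) w x; g \<in> hom (structured_category C S U Q) x y\<rbrakk>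
      \<Longrightarrow> g \<cdot>\<^bsub>structured_category C S U Q\<^esub> f \<in> hom (structured_category C S U Q) w y"
    using Comp Comp_in_hom by (auto simp: structured_category_def hom_def)
qed (use U Id in \<open>auto simp: structured_category_def hom_def\<close>)

lemma cat_functor_over_identity:
  assumes "category (structured_category C S U Q)" "category (structured_category C S' U' Q')"
    and "\<And>x. x \<in> S \<Longrightarrow> F x \<in> S' \<and> U' (F x) = U x"
    and "\<And>x y f. \<lbrakk>x \<in> S; y \<in> S; f \<in> hom C (U x) (U y); Q x y f\<rbrakk> \<Longrightarrow> Q' (F x) (F y) f"
  shows "cat_functor (structured_category C S U Q) (structured_category C S' U' Q') (over_identity F)"
  using assms unfolding cat_functor_def cat_functor_axioms_def
  by (auto simp: structured_category_def over_identity_def hom_def)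

text \<open>On arrows both functors only relabel the endpoints, so being inverse on arrows reduces
  to being inverse on objects.\<close>

lemma inverse_functors_over_identity:
  assumes "category (structured_category C S U Q)" "category (structured_category C S' U' Q')"
    and "\<And>x. x \<in> S \<Longrightarrow> F x \<in> S' \<and> U' (F x) = U x" "\<And>y. y \<in> S' \<Longrightarrow> G y \<in> S \<and> U (G y) = U' y"
    and "\<And>x y f. \<lbrakk>x \<in> S; y \<in> S; f \<in> hom C (U x) (U y); Q x y f\<rbrakk> \<Longrightarrow> Q' (F x) (F y) f"
    and "\<And>x y f. \<lbrakk>x \<in> S'; y \<in> S'; f \<in> hom C (U' x) (U' y); Q' x y f\<rbrakk> \<Longrightarrow> Q (G x) (G y) f"
    and "\<And>x. x \<in> S \<Longrightarrow> G (F x) = x" "\<And>y. y \<in> S' \<Longrightarrow> F (G y) = y"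
  shows "inverse_functors (structured_category C S U Q) (structured_category C S' U' Q')
    (over_identity F) (over_identity G)"
  unfolding inverse_functors_def
proof (intro conjI)
  show "cat_functor (structured_category C S U Q) (structured_category C S' U' Q') (over_identity F)"
    by (rule cat_functor_over_identity) (use assms in auto)
  show "cat_functor (structured_category C S' U' Q') (structured_category C S U Q) (over_identity G)"
    by (rule cat_functor_over_identity) (use assms in auto)
qed (use assms(7,8) in \<open>auto simp: structured_category_def over_identity_def\<close>)

section \<open>Binary coproducts\<close>

context finite_coproducts
begin

lemma Cop_simps [simp]:
  assumes "X \<in> Ob C" "Y \<in> Ob C"
  shows "Cop K X Y \<in> Ob C"
    "Inl K X Y \<in> Ar C" "Dom C (Inl K X Y) = X" "Cod C (Inl K X Y) = Cop K X Y"
    "Inr K X Y \<in> Ar C" "Dom C (Inr K X Y) = Y" "Cod C (Inr K X Y) = Cop K X Y"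
  using Cop_in_Ob[OF assms] homD[OF Inl_in_hom[OF assms]] homD[OF Inr_in_hom[OF assms]] by auto

text \<open>The domains enter through premises such as \<open>Dom C f = X\<close>, so that the rules
  match injections whose indices are already simplified.\<close>

lemma copair_simps [simp]:
  assumes "f \<in> Ar C" "g \<in> Ar C" "Cod C g = Cod C f" "Dom C f = X" "Dom C g = Y"
  shows "copair C K f g \<in> Ar C" "Dom C (copair C K f g) = Cop K X Y"
    "Cod C (copair C K f g) = Cod C f"
    "copair C K f g \<cdot> Inl K X Y = f" "copair C K f g \<cdot> Inr K X Y = g"
proof -
  have "\<exists>!h. h \<in> hom C (Cop K X Y) (Cod C f) \<and> h \<cdot> Inl K X Y = f \<and> h \<cdot> Inr K X Y = g"
    by (rule Cop_universal) (use assms in \<open>auto simp: hom_def\<close>)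
  from theI'[OF this]
  have "copair C K f g \<in> hom C (Cop K X Y) (Cod C f) \<and>
      copair C K f g \<cdot> Inl K X Y = f \<and> copair C K f g \<cdot> Inr K X Y = g"
    unfolding copair_def assms(4,5) .
  then show "copair C K f g \<in> Ar C" "Dom C (copair C K f g) = Cop K X Y"
    "Cod C (copair C K f g) = Cod C f"
    "copair C K f g \<cdot> Inl K X Y = f" "copair C K f g \<cdot> Inr K X Y = g"
    by (auto simp: hom_def)
qed

text \<open>The uniqueness half of \<open>Cop_universal\<close>: the injections are jointly
  epimorphic.\<close>

lemma Cop_arrow_eqI:
  assumes "h \<in> hom C (Cop K X Y) Z" "h' \<in> hom C (Cop K X Y) Z" "X \<in> Ob C" "Y \<in> Ob C"
    and "h \<cdot> Inl K X Y = h' \<cdot> Inl K X Y" "h \<cdot> Inr K X Y = h' \<cdot> Inr K X Y"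
  shows "h = h'"
proof -
  note [simp] = homD[OF assms(1)] homD[OF assms(2)]
  have "\<exists>!k. k \<in> hom C (Cop K X Y) Z \<and> k \<cdot> Inl K X Y = h \<cdot> Inl K X Y \<and> k \<cdot> Inr K X Y = h \<cdot> Inr K X Y"
    by (rule Cop_universal) (use assms(3,4) in \<open>auto intro!: homI\<close>)
  then show ?thesis
    using assms by metis
qed

end

section \<open>Parametrized monads\<close>

context parametrized_monad
begin

lemma TOb_in_Ob [simp]: "\<lbrakk>A \<in> Ob C; X \<in> Ob C\<rbrakk> \<Longrightarrow> A \<sharp>\<^bsub>P\<^esub> X \<in> Ob C"
  using cat_functor.FOb_in_Ob[OF bifunctor, of "(A, X)"]
  by (simp add: product_category_def bifunctor_of_def)

lemma TAr_simps [simp]: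
  assumes "f \<in> Ar C" "g \<in> Ar C"
  shows "f \<otimes>\<^bsub>P\<^esub> g \<in> Ar C"
    "Dom C (f \<otimes>\<^bsub>P\<^esub> g) = Dom C f \<sharp>\<^bsub>P\<^esub> Dom C g"
    "Cod C (f \<otimes>\<^bsub>P\<^esub> g) = Cod C f \<sharp>\<^bsub>P\<^esub> Cod C g"
  using cat_functor.FAr_in_hom[OF bifunctor, of "(f, g)" "(Dom C f, Dom C g)" "(Cod C f, Cod C g)"] assms
  by (simp_all add: product_category_def bifunctor_of_def hom_def)

lemma TAr_Id [simp]: "\<lbrakk>A \<in> Ob C; X \<in> Ob C\<rbrakk> \<Longrightarrow> Id C A \<otimes>\<^bsub>P\<^esub> Id C X = Id C (A \<sharp>\<^bsub>P\<^esub> X)"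
  using cat_functor.FAr_Id[OF bifunctor, of "(A, X)"]
  by (simp add: product_category_def bifunctor_of_def)

lemma TAr_Comp [simp]:
  assumes "f \<in> Ar C" "g \<in> Ar C" "f' \<in> Ar C" "g' \<in> Ar C" "Dom C f' = Cod C f" "Dom C g' = Cod C g"
  shows "(f' \<otimes>\<^bsub>P\<^esub> g') \<cdot> (f \<otimes>\<^bsub>P\<^esub> g) = (f' \<cdot> f) \<otimes>\<^bsub>P\<^esub> (g' \<cdot> g)"
  using cat_functor.FAr_Comp[OF bifunctor, of "(f, g)" "(Dom C f, Dom C g)" "(Cod C f, Cod C g)"
      "(f', g')" "(Cod C f', Cod C g')"] assms
  by (simp add: product_category_def bifunctor_of_def hom_def)

lemma TAr_Comp_tail [simp]:
  assumes "f \<in> Ar C" "g \<in> Ar C" "f' \<in> Ar C" "g' \<in> Ar C" "Dom C f' = Cod C f" "Dom C g' = Cod C g"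
    and "k \<in> Ar C" "Cod C k = Dom C f \<sharp>\<^bsub>P\<^esub> Dom C g"
  shows "(f' \<otimes>\<^bsub>P\<^esub> g') \<cdot> ((f \<otimes>\<^bsub>P\<^esub> g) \<cdot> k) = ((f' \<cdot> f) \<otimes>\<^bsub>P\<^esub> (g' \<cdot> g)) \<cdot> k"
proof -
  have "(f' \<otimes>\<^bsub>P\<^esub> g') \<cdot> ((f \<otimes>\<^bsub>P\<^esub> g) \<cdot> k) = ((f' \<otimes>\<^bsub>P\<^esub> g') \<cdot> (f \<otimes>\<^bsub>P\<^esub> g)) \<cdot> k"
    using assms by (simp del: TAr_Comp)
  then show ?thesis
    using assms by simp
qed

lemma UnitP_simps [simp]:
  assumes "A \<in> Ob C" "X \<in> Ob C"
  shows "UnitP P X A \<in> Ar C" "Dom C (UnitP P X A) = A" "Cod C (UnitP P X A) = A \<sharp>\<^bsub>P\<^esub> X"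
  using cat_monad.Eta_natural[OF monad_at[OF assms(2)]] assms(1)
  by (auto simp: nat_trans_def monad_at_def identity_functor_def hom_def)

lemma MultP_simps [simp]:
  assumes "A \<in> Ob C" "X \<in> Ob C"
  shows "MultP P X A \<in> Ar C" "Dom C (MultP P X A) = A \<sharp>\<^bsub>P\<^esub> X \<sharp>\<^bsub>P\<^esub> X"
    "Cod C (MultP P X A) = A \<sharp>\<^bsub>P\<^esub> X"
  using cat_monad.Mu_natural[OF monad_at[OF assms(2)]] assms(1)
  by (auto simp: nat_trans_def monad_at_def comp_functor_def hom_def)

text \<open>\<open>f \<otimes> g\<close> factors as
  \<open>(f \<otimes> Id) \<cdot> (Id \<otimes> g)\<close>. The first factor passes the unit by
  naturality within one monad, the second because \<open>Id \<otimes> g\<close> is a monad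
  morphism.\<close>

lemma UnitP_natural [simp]:
  assumes "f \<in> Ar C" "g \<in> Ar C" "Dom C f = A" "Dom C g = X"
  shows "(f \<otimes>\<^bsub>P\<^esub> g) \<cdot> UnitP P X A = UnitP P (Cod C g) (Cod C f) \<cdot> f"
proof -
  define B Y where "B = Cod C f" and "Y = Cod C g"
  have ob [simp]: "A \<in> Ob C" "X \<in> Ob C" "B \<in> Ob C" "Y \<in> Ob C"
    using assms Dom_in_Ob Cod_in_Ob by (auto simp: B_def Y_def)
  note [simp] = assms B_def[symmetric] Y_def[symmetric]
  have g: "(Id C A \<otimes>\<^bsub>P\<^esub> g) \<cdot> UnitP P X A = UnitP P Y A"
    using monad_morphism_at[of g X Y] by (auto simp: monad_morphism_def monad_at_def hom_def)
  have f: "(f \<otimes>\<^bsub>P\<^esub> Id C Y) \<cdot> UnitP P Y A = UnitP P Y B \<cdot> f"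
    using nat_transD[OF cat_monad.Eta_natural[OF monad_at], of Y f A B]
    by (simp add: monad_at_def identity_functor_def homI)
  have "(f \<otimes>\<^bsub>P\<^esub> g) \<cdot> UnitP P X A = (f \<otimes>\<^bsub>P\<^esub> Id C Y) \<cdot> ((Id C A \<otimes>\<^bsub>P\<^esub> g) \<cdot> UnitP P X A)"
    by simp
  then show ?thesis
    unfolding g f by simp
qed

text \<open>The factorisation used for the unit works again; the monad morphism law now contributes
  \<open>g\<close> twice, once for each of the two layers that are multiplied.\<close>

lemma MultP_natural [simp]:
  assumes "f \<in> Ar C" "g \<in> Ar C" "Dom C f = A" "Dom C g = X"
  shows "(f \<otimes>\<^bsub>P\<^esub> g) \<cdot> MultP P X A = MultP P (Cod C g) (Cod C f) \<cdot> (f \<otimes>\<^bsub>P\<^esub> g \<otimes>\<^bsub>P\<^esub> g)"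
proof -
  define B Y where "B = Cod C f" and "Y = Cod C g"
  have ob [simp]: "A \<in> Ob C" "X \<in> Ob C" "B \<in> Ob C" "Y \<in> Ob C"
    using assms Dom_in_Ob Cod_in_Ob by (auto simp: B_def Y_def)
  note [simp] = assms B_def[symmetric] Y_def[symmetric]
  have "(Id C A \<otimes>\<^bsub>P\<^esub> g) \<cdot> MultP P X A
      = MultP P Y A \<cdot> ((Id C A \<otimes>\<^bsub>P\<^esub> g \<otimes>\<^bsub>P\<^esub> Id C Y) \<cdot> (Id C (A \<sharp>\<^bsub>P\<^esub> X) \<otimes>\<^bsub>P\<^esub> g))"
    using monad_morphism_at[of g X Y] by (auto simp: monad_morphism_def monad_at_def hom_def)
  then have g: "(Id C A \<otimes>\<^bsub>P\<^esub> g) \<cdot> MultP P X A = MultP P Y A \<cdot> (Id C A \<otimes>\<^bsub>P\<^esub> g \<otimes>\<^bsub>P\<^esub> g)"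
    by simp
  have f: "(f \<otimes>\<^bsub>P\<^esub> Id C Y) \<cdot> MultP P Y A = MultP P Y B \<cdot> (f \<otimes>\<^bsub>P\<^esub> Id C Y \<otimes>\<^bsub>P\<^esub> Id C Y)"
    using nat_transD[OF cat_monad.Mu_natural[OF monad_at], of Y f A B]
    by (simp add: monad_at_def comp_functor_def homI)
  have "(f \<otimes>\<^bsub>P\<^esub> g) \<cdot> MultP P X A = (f \<otimes>\<^bsub>P\<^esub> Id C Y) \<cdot> ((Id C A \<otimes>\<^bsub>P\<^esub> g) \<cdot> MultP P X A)"
    by simp
  also have "\<dots> = ((f \<otimes>\<^bsub>P\<^esub> Id C Y) \<cdot> MultP P Y A) \<cdot> (Id C A \<otimes>\<^bsub>P\<^esub> g \<otimes>\<^bsub>P\<^esub> g)"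
    unfolding g by simp
  also have "\<dots> = MultP P Y B \<cdot> (f \<otimes>\<^bsub>P\<^esub> g \<otimes>\<^bsub>P\<^esub> g)"
    unfolding f by simp
  finally show ?thesis
    by simp
qed

lemma MultP_UnitP [simp]:
  "\<lbrakk>A \<in> Ob C; X \<in> Ob C\<rbrakk> \<Longrightarrow> MultP P X A \<cdot> UnitP P X (A \<sharp>\<^bsub>P\<^esub> X) = Id C (A \<sharp>\<^bsub>P\<^esub> X)"
  using cat_monad.Mu_Eta[OF monad_at, of X A] by (simp add: monad_at_def)

text \<open>An arbitrary \<open>g\<close> stands in the second argument because
  \<open>TAr_Comp\<close> merges neighbouring factors, after which the plain unit law would no
  longer match.\<close>

lemma MultP_TAr_UnitP [simp]:
  assumes "A \<in> Ob C" "g \<in> Ar C" "Cod C g = X"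
  shows "MultP P X A \<cdot> (UnitP P X A \<otimes>\<^bsub>P\<^esub> g) = Id C A \<otimes>\<^bsub>P\<^esub> g"
proof -
  have [simp]: "X \<in> Ob C"
    using assms Cod_in_Ob by auto
  have "MultP P X A \<cdot> (UnitP P X A \<otimes>\<^bsub>P\<^esub> Id C X) = Id C (A \<sharp>\<^bsub>P\<^esub> X)"
    using cat_monad.Mu_FAr_Eta[OF monad_at, of X A] assms by (simp add: monad_at_def)
  moreover have "MultP P X A \<cdot> (UnitP P X A \<otimes>\<^bsub>P\<^esub> g)
      = (MultP P X A \<cdot> (UnitP P X A \<otimes>\<^bsub>P\<^esub> Id C X)) \<cdot> (Id C A \<otimes>\<^bsub>P\<^esub> g)"
    using assms by simp
  ultimately show ?thesis
    using assms by simp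
qed

lemma MultP_MultP:
  assumes "A \<in> Ob C" "X \<in> Ob C"
  shows "MultP P X A \<cdot> MultP P X (A \<sharp>\<^bsub>P\<^esub> X) = MultP P X A \<cdot> (MultP P X A \<otimes>\<^bsub>P\<^esub> Id C X)"
  using cat_monad.Mu_Mu[OF monad_at, of X A] assms by (simp add: monad_at_def)

end

section \<open>Corecursion and the monad of final coalgebras\<close>

locale final_coalgebras = finite_coproducts C K + parametrized_monad C P
  for C :: "('o, 'm) precat" (structure)
    and K :: "('o, 'm) coproduct_data"
    and P :: "('o, 'm) pmonad_data" +
  fixes \<Phi> :: "'o \<Rightarrow> 'o"
    and out :: "'o \<Rightarrow> 'm"
  assumes final: "X \<in> Ob C \<Longrightarrow> final_coalgebra C (functor_at C P X) (\<Phi> X) (out X)"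
begin

abbreviation "coit\<^sub>\<Phi> \<equiv> coit C P \<Phi> out"
abbreviation "unit\<^sub>\<Phi> \<equiv> nu_unit C P \<Phi> out"
abbreviation "lift\<^sub>\<Phi> \<equiv> nu_lift C P \<Phi> out"
abbreviation "map\<^sub>\<Phi> \<equiv> FAr (MFun (nu_monad C P \<Phi> out))"
abbreviation "join\<^sub>\<Phi> \<equiv> Mu (nu_monad C P \<Phi> out)"
abbreviation "out_inv X \<equiv> inverse_ar C (out X)"

section \<open>Coiteration and invertibility of final coalgebras\<close>

lemma out_simps [simp]:
  assumes "X \<in> Ob C"
  shows "\<Phi> X \<in> Ob C" "out X \<in> Ar C" "Dom C (out X) = \<Phi> X" "Cod C (out X) = X \<sharp>\<^bsub>P\<^esub> \<Phi> X"
  using final[OF assms] by (auto simp: final_coalgebra_def functor_at_def hom_def)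

lemma coit_ex1:
  assumes "A \<in> Ob C" "e \<in> hom C X (A \<sharp>\<^bsub>P\<^esub> X)"
  shows "\<exists>!h. h \<in> hom C X (\<Phi> A) \<and> out A \<cdot> h = (Id C A \<otimes>\<^bsub>P\<^esub> h) \<cdot> e"
  using final[OF assms(1)] hom_in_Ob[OF assms(2)] assms(2)
  by (simp add: final_coalgebra_def functor_at_def coalgebra_morphism_def)

lemma coit_spec:
  assumes "A \<in> Ob C" "e \<in> hom C X (A \<sharp>\<^bsub>P\<^esub> X)"
  shows "coit\<^sub>\<Phi> A e \<in> hom C X (\<Phi> A)" "out A \<cdot> coit\<^sub>\<Phi> A e = (Id C A \<otimes>\<^bsub>P\<^esub> coit\<^sub>\<Phi> A e) \<cdot> e"
  using theI'[OF coit_ex1[OF assms]] homD[OF assms(2)]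
  by (simp_all add: coit_def functor_at_def coalgebra_morphism_def)

lemma coit_simps [simp]:
  assumes "A \<in> Ob C" "e \<in> Ar C" "Cod C e = A \<sharp>\<^bsub>P\<^esub> Dom C e"
  shows "coit\<^sub>\<Phi> A e \<in> Ar C" "Dom C (coit\<^sub>\<Phi> A e) = Dom C e" "Cod C (coit\<^sub>\<Phi> A e) = \<Phi> A"
  using homD[OF coit_spec(1)[of A e "Dom C e"]] assms by (auto simp: hom_def)

lemma coit_eqI:
  assumes "A \<in> Ob C" "e \<in> hom C X (A \<sharp>\<^bsub>P\<^esub> X)"
    and "h \<in> hom C X (\<Phi> A)" "out A \<cdot> h = (Id C A \<otimes>\<^bsub>P\<^esub> h) \<cdot> e"
  shows "coit\<^sub>\<Phi> A e = h"
  using coit_ex1[OF assms(1,2)] coit_spec[OF assms(1,2)] assms(3,4) by metis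

text \<open>Coalgebra morphisms compose, so finality identifies the composite with
  \<open>coit\<^sub>\<Phi> A e\<close>. This is the functoriality law of iteration at the level of
  \<open>\<Phi>\<close>.\<close>

lemma coit_comp:
  assumes "A \<in> Ob C" "e \<in> hom C X (A \<sharp>\<^bsub>P\<^esub> X)" "f \<in> hom C Y (A \<sharp>\<^bsub>P\<^esub> Y)" "h \<in> hom C X Y"
    and "f \<cdot> h = (Id C A \<otimes>\<^bsub>P\<^esub> h) \<cdot> e"
  shows "coit\<^sub>\<Phi> A f \<cdot> h = coit\<^sub>\<Phi> A e"
proof (rule coit_eqI[symmetric, OF assms(1,2)])
  note [simp] = assms(1) homD[OF assms(2)] homD[OF assms(3)] homD[OF assms(4)]
  show "coit\<^sub>\<Phi> A f \<cdot> h \<in> hom C X (\<Phi> A)"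
    by (rule homI) auto
  have "out A \<cdot> (coit\<^sub>\<Phi> A f \<cdot> h) = (out A \<cdot> coit\<^sub>\<Phi> A f) \<cdot> h"
    by simp
  also have "\<dots> = (Id C A \<otimes>\<^bsub>P\<^esub> coit\<^sub>\<Phi> A f) \<cdot> (f \<cdot> h)"
    unfolding coit_spec(2)[OF assms(1,3)] by simp
  also have "\<dots> = (Id C A \<otimes>\<^bsub>P\<^esub> (coit\<^sub>\<Phi> A f \<cdot> h)) \<cdot> e"
    unfolding assms(5) by simp
  finally show "out A \<cdot> (coit\<^sub>\<Phi> A f \<cdot> h) = (Id C A \<otimes>\<^bsub>P\<^esub> (coit\<^sub>\<Phi> A f \<cdot> h)) \<cdot> e" .
qed

lemma coit_out [simp]: "A \<in> Ob C \<Longrightarrow> coit\<^sub>\<Phi> A (out A) = Id C (\<Phi> A)"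
  by (rule coit_eqI) (auto intro!: homI)

text \<open>Lambek's lemma: the inverse of \<open>out\<close> is induced by the coalgebra \<open>Id \<otimes> out\<close>.\<close>

lemma out_inv_spec:
  assumes [simp]: "A \<in> Ob C"
  shows "out_inv A \<in> hom C (A \<sharp>\<^bsub>P\<^esub> \<Phi> A) (\<Phi> A)"
    "out_inv A \<cdot> out A = Id C (\<Phi> A)" "out A \<cdot> out_inv A = Id C (A \<sharp>\<^bsub>P\<^esub> \<Phi> A)"
proof -
  let ?c = "Id C A \<otimes>\<^bsub>P\<^esub> out A"
  let ?i = "coit\<^sub>\<Phi> A ?c"
  have c: "?c \<in> hom C (A \<sharp>\<^bsub>P\<^esub> \<Phi> A) (A \<sharp>\<^bsub>P\<^esub> (A \<sharp>\<^bsub>P\<^esub> \<Phi> A))"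
    by (rule homI) auto
  have i: "?i \<in> hom C (A \<sharp>\<^bsub>P\<^esub> \<Phi> A) (\<Phi> A)"
    by (rule homI) auto
  have 1: "?i \<cdot> out A = Id C (\<Phi> A)"
    using coit_comp[OF assms _ c, of "out A" "\<Phi> A" "out A"] by (simp add: homI)
  have 2: "out A \<cdot> ?i = Id C (A \<sharp>\<^bsub>P\<^esub> \<Phi> A)"
    unfolding coit_spec(2)[OF assms c] by (simp add: 1)
  have "out_inv A = ?i"
    by (rule inverse_ar_eqI[OF _ i 1 2]) (simp add: homI)
  with i 1 2 show "out_inv A \<in> hom C (A \<sharp>\<^bsub>P\<^esub> \<Phi> A) (\<Phi> A)"
    "out_inv A \<cdot> out A = Id C (\<Phi> A)" "out A \<cdot> out_inv A = Id C (A \<sharp>\<^bsub>P\<^esub> \<Phi> A)"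
    by simp_all
qed

lemma out_inv_simps [simp]:
  assumes "A \<in> Ob C"
  shows "out_inv A \<in> Ar C" "Dom C (out_inv A) = A \<sharp>\<^bsub>P\<^esub> \<Phi> A" "Cod C (out_inv A) = \<Phi> A"
    "out_inv A \<cdot> out A = Id C (\<Phi> A)" "out A \<cdot> out_inv A = Id C (A \<sharp>\<^bsub>P\<^esub> \<Phi> A)"
  using homD[OF out_inv_spec(1)[OF assms]] out_inv_spec(2,3)[OF assms] by auto

lemma out_inv_out_tail [simp]:
  assumes "A \<in> Ob C" "k \<in> Ar C" "Cod C k = \<Phi> A"
  shows "out_inv A \<cdot> (out A \<cdot> k) = k"
proof -
  have "out_inv A \<cdot> (out A \<cdot> k) = (out_inv A \<cdot> out A) \<cdot> k"
    using assms by (simp del: out_inv_simps(4,5))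
  then show ?thesis
    using assms by simp
qed

lemma out_out_inv_tail [simp]:
  assumes "A \<in> Ob C" "k \<in> Ar C" "Cod C k = A \<sharp>\<^bsub>P\<^esub> \<Phi> A"
  shows "out A \<cdot> (out_inv A \<cdot> k) = k"
proof -
  have "out A \<cdot> (out_inv A \<cdot> k) = (out A \<cdot> out_inv A) \<cdot> k"
    using assms by (simp del: out_inv_simps(4,5))
  then show ?thesis
    using assms by simp
qed

lemma out_mono:
  assumes "A \<in> Ob C" "h \<in> hom C X (\<Phi> A)" "k \<in> hom C X (\<Phi> A)" "out A \<cdot> h = out A \<cdot> k"
  shows "h = k"
  by (metis assms homD(1,3) out_inv_out_tail)

text \<open>The coalgebra lives on \<open>Cop X (\<Phi> A)\<close>; on the second summand its coiteration is the identity.\<close>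

lemma corecursion_ex1:
  assumes "A \<in> Ob C" "g \<in> hom C X (B \<sharp>\<^bsub>P\<^esub> X)" "h \<in> hom C B (\<Phi> A)"
  shows "\<exists>!k. k \<in> hom C X (\<Phi> A) \<and>
    out A \<cdot> k = MultP P (\<Phi> A) A \<cdot> (((out A \<cdot> h) \<otimes>\<^bsub>P\<^esub> k) \<cdot> g)"
proof -
  note [simp] = assms(1) homD[OF assms(2)] homD[OF assms(3)]
  have [simp]: "X \<in> Ob C" "B \<in> Ob C"
    using hom_in_Ob assms by auto
  define S l r where "S = Cop K X (\<Phi> A)" and "l = Inl K X (\<Phi> A)" and "r = Inr K X (\<Phi> A)"
  have [simp]: "S \<in> Ob C" "l \<in> Ar C" "Dom C l = X" "Cod C l = S"
      "r \<in> Ar C" "Dom C r = \<Phi> A" "Cod C r = S"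
    by (auto simp: S_def l_def r_def)
  \<comment> \<open>\<open>e1\<close> unfolds the wanted equation once: parameters in
    \<open>B\<close> pass through \<open>h\<close> and \<open>out A\<close> into the summand
    \<open>\<Phi> A\<close>, recursive calls stay in the summand \<open>X\<close>, and
    \<open>MultP\<close> flattens the two layers. \<open>e2\<close> copies \<open>out A\<close> into
    its summand.\<close>
  define e1 where "e1 = MultP P S A \<cdot> ((((Id C A \<otimes>\<^bsub>P\<^esub> r) \<cdot> (out A \<cdot> h)) \<otimes>\<^bsub>P\<^esub> l) \<cdot> g)"
  define e2 where "e2 = (Id C A \<otimes>\<^bsub>P\<^esub> r) \<cdot> out A"
  have [simp]: "e1 \<in> Ar C" "Dom C e1 = X" "Cod C e1 = A \<sharp>\<^bsub>P\<^esub> S"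
      "e2 \<in> Ar C" "Dom C e2 = \<Phi> A" "Cod C e2 = A \<sharp>\<^bsub>P\<^esub> S"
    by (auto simp: e1_def e2_def)
  define e where "e = copair C K e1 e2"
  have e_simps [simp]: "e \<in> Ar C" "Dom C e = S" "Cod C e = A \<sharp>\<^bsub>P\<^esub> S"
    and el: "e \<cdot> l = e1" and er: "e \<cdot> r = e2"
    by (auto simp: e_def S_def l_def r_def)
  have e: "e \<in> hom C S (A \<sharp>\<^bsub>P\<^esub> S)"
    by (rule homI) auto
  \<comment> \<open>For any \<open>c\<close> that is the identity on \<open>\<Phi> A\<close>, the
    \<open>X\<close>-component of being a coalgebra morphism from \<open>e\<close> is exactly the
    corecursive equation for \<open>c \<cdot> l\<close>. Existence uses this with \<open>c\<close>
    the coiteration, uniqueness with a copairing.\<close>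
  have comp_e1: "(Id C A \<otimes>\<^bsub>P\<^esub> c) \<cdot> e1 =
      MultP P (\<Phi> A) A \<cdot> (((out A \<cdot> h) \<otimes>\<^bsub>P\<^esub> (c \<cdot> l)) \<cdot> g)"
    if c: "c \<in> hom C S (\<Phi> A)" and cr: "c \<cdot> r = Id C (\<Phi> A)" for c
  proof -
    note [simp] = homD[OF c]
    have "(Id C A \<otimes>\<^bsub>P\<^esub> c) \<cdot> e1 =
       ((Id C A \<otimes>\<^bsub>P\<^esub> c) \<cdot> MultP P S A) \<cdot> ((((Id C A \<otimes>\<^bsub>P\<^esub> r) \<cdot> (out A \<cdot> h)) \<otimes>\<^bsub>P\<^esub> l) \<cdot> g)"
      by (simp add: e1_def del: MultP_natural)
    then show ?thesis
      by (simp add: cr)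
  qed
  show ?thesis
  proof (rule ex_ex1I)
    let ?c = "coit\<^sub>\<Phi> A e"
    have c: "?c \<in> hom C S (\<Phi> A)"
      by (rule homI) auto
    have "?c \<cdot> r = coit\<^sub>\<Phi> A (out A)"
      by (rule coit_comp[OF assms(1) _ e]) (auto intro!: homI simp: er e2_def)
    then have cr: "?c \<cdot> r = Id C (\<Phi> A)"
      by simp
    have "out A \<cdot> (?c \<cdot> l) = (out A \<cdot> ?c) \<cdot> l"
      by simp
    also have "\<dots> = (Id C A \<otimes>\<^bsub>P\<^esub> ?c) \<cdot> e1"
      unfolding coit_spec(2)[OF assms(1) e] by (simp add: el)
    also have "\<dots> = MultP P (\<Phi> A) A \<cdot> (((out A \<cdot> h) \<otimes>\<^bsub>P\<^esub> (?c \<cdot> l)) \<cdot> g)"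
      by (rule comp_e1[OF c cr])
    finally show "\<exists>k. k \<in> hom C X (\<Phi> A) \<and>
        out A \<cdot> k = MultP P (\<Phi> A) A \<cdot> (((out A \<cdot> h) \<otimes>\<^bsub>P\<^esub> k) \<cdot> g)"
      by (intro exI[of _ "?c \<cdot> l"]) (simp add: homI)
  next
    \<comment> \<open>A solution \<open>k\<close>, copaired with the identity, is a coalgebra
      morphism out of \<open>e\<close>, so finality forces it to be the coiteration of
      \<open>e\<close>.\<close>
    have *: "coit\<^sub>\<Phi> A e \<cdot> l = k"
      if k: "k \<in> hom C X (\<Phi> A) \<and>
        out A \<cdot> k = MultP P (\<Phi> A) A \<cdot> (((out A \<cdot> h) \<otimes>\<^bsub>P\<^esub> k) \<cdot> g)" for k
    proof -
      have [simp]: "k \<in> Ar C" "Dom C k = X" "Cod C k = \<Phi> A"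
        using k by (auto simp: hom_def)
      define c where "c = copair C K k (Id C (\<Phi> A))"
      have c_simps [simp]: "c \<in> Ar C" "Dom C c = S" "Cod C c = \<Phi> A"
        and cl: "c \<cdot> l = k" and cr: "c \<cdot> r = Id C (\<Phi> A)"
        by (auto simp: c_def S_def l_def r_def)
      have c: "c \<in> hom C S (\<Phi> A)"
        by (rule homI) auto
      have "coit\<^sub>\<Phi> A e = c"
      proof (rule coit_eqI[OF assms(1) e c], rule Cop_arrow_eqI[of _ X "\<Phi> A"])
        show "out A \<cdot> c \<in> hom C (Cop K X (\<Phi> A)) (A \<sharp>\<^bsub>P\<^esub> \<Phi> A)"
          "(Id C A \<otimes>\<^bsub>P\<^esub> c) \<cdot> e \<in> hom C (Cop K X (\<Phi> A)) (A \<sharp>\<^bsub>P\<^esub> \<Phi> A)"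
          by (auto intro!: homI simp: S_def[symmetric])
        have "(out A \<cdot> c) \<cdot> l = ((Id C A \<otimes>\<^bsub>P\<^esub> c) \<cdot> e) \<cdot> l"
          using k comp_e1[OF c cr] by (simp add: cl el)
        then show "(out A \<cdot> c) \<cdot> Inl K X (\<Phi> A) = ((Id C A \<otimes>\<^bsub>P\<^esub> c) \<cdot> e) \<cdot> Inl K X (\<Phi> A)"
          unfolding l_def .
        have "(out A \<cdot> c) \<cdot> r = ((Id C A \<otimes>\<^bsub>P\<^esub> c) \<cdot> e) \<cdot> r"
          by (simp add: cr er e2_def)
        then show "(out A \<cdot> c) \<cdot> Inr K X (\<Phi> A) = ((Id C A \<otimes>\<^bsub>P\<^esub> c) \<cdot> e) \<cdot> Inr K X (\<Phi> A)"
          unfolding r_def .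
      qed simp_all
      then show ?thesis
        by (simp add: cl)
    qed
    fix k k'
    assume "k \<in> hom C X (\<Phi> A) \<and>
        out A \<cdot> k = MultP P (\<Phi> A) A \<cdot> (((out A \<cdot> h) \<otimes>\<^bsub>P\<^esub> k) \<cdot> g)"
      and "k' \<in> hom C X (\<Phi> A) \<and>
        out A \<cdot> k' = MultP P (\<Phi> A) A \<cdot> (((out A \<cdot> h) \<otimes>\<^bsub>P\<^esub> k') \<cdot> g)"
    from *[OF this(1)] *[OF this(2)] show "k = k'"
      by simp
  qed
qed

section \<open>Kleisli lifting and its laws\<close>

lemma lift_spec:
  assumes "A \<in> Ob C" "h \<in> hom C B (\<Phi> A)"
  shows "lift\<^sub>\<Phi> B A h \<in> hom C (\<Phi> B) (\<Phi> A)"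
    "out A \<cdot> lift\<^sub>\<Phi> B A h = MultP P (\<Phi> A) A \<cdot> (((out A \<cdot> h) \<otimes>\<^bsub>P\<^esub> lift\<^sub>\<Phi> B A h) \<cdot> out B)"
proof -
  have "out B \<in> hom C (\<Phi> B) (B \<sharp>\<^bsub>P\<^esub> \<Phi> B)"
    using hom_in_Ob[OF assms(2)] by (simp add: homI)
  from theI'[OF corecursion_ex1[OF assms(1) this assms(2)]]
  show "lift\<^sub>\<Phi> B A h \<in> hom C (\<Phi> B) (\<Phi> A)"
    "out A \<cdot> lift\<^sub>\<Phi> B A h = MultP P (\<Phi> A) A \<cdot> (((out A \<cdot> h) \<otimes>\<^bsub>P\<^esub> lift\<^sub>\<Phi> B A h) \<cdot> out B)"
    by (simp_all add: nu_lift_def)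
qed

lemma lift_simps [simp]:
  assumes "A \<in> Ob C" "h \<in> Ar C" "Dom C h = B" "Cod C h = \<Phi> A"
  shows "lift\<^sub>\<Phi> B A h \<in> Ar C" "Dom C (lift\<^sub>\<Phi> B A h) = \<Phi> B" "Cod C (lift\<^sub>\<Phi> B A h) = \<Phi> A"
  using homD[OF lift_spec(1)[of A h B]] assms by (auto simp: hom_def)

lemma lift_eqI:
  assumes "A \<in> Ob C" "h \<in> hom C B (\<Phi> A)" "k \<in> hom C (\<Phi> B) (\<Phi> A)"
    and "out A \<cdot> k = MultP P (\<Phi> A) A \<cdot> (((out A \<cdot> h) \<otimes>\<^bsub>P\<^esub> k) \<cdot> out B)"
  shows "lift\<^sub>\<Phi> B A h = k"
proof -
  have "out B \<in> hom C (\<Phi> B) (B \<sharp>\<^bsub>P\<^esub> \<Phi> B)"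
    using hom_in_Ob[OF assms(2)] by (simp add: homI)
  from corecursion_ex1[OF assms(1) this assms(2)] show ?thesis
    using lift_spec[OF assms(1,2)] assms(3,4) by metis
qed

text \<open>Since \<open>coit\<^sub>\<Phi> B g\<close> is a coalgebra morphism, composing it with
  the lifting satisfies the corecursive equation along \<open>g\<close>, whose solution is unique.
  Thus corecursion along any \<open>g\<close> factors through the final coalgebra.\<close>

lemma lift_coit_eqI:
  assumes "A \<in> Ob C" "g \<in> hom C X (B \<sharp>\<^bsub>P\<^esub> X)" "h \<in> hom C B (\<Phi> A)" "k \<in> hom C X (\<Phi> A)"
    and "out A \<cdot> k = MultP P (\<Phi> A) A \<cdot> (((out A \<cdot> h) \<otimes>\<^bsub>P\<^esub> k) \<cdot> g)"
  shows "lift\<^sub>\<Phi> B A h \<cdot> coit\<^sub>\<Phi> B g = k"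
proof -
  note [simp] = assms(1) homD[OF assms(2)] homD[OF assms(3)] homD[OF assms(4)]
  have B [simp]: "B \<in> Ob C" and [simp]: "X \<in> Ob C"
    using hom_in_Ob assms by auto
  have "out A \<cdot> (lift\<^sub>\<Phi> B A h \<cdot> coit\<^sub>\<Phi> B g) = (out A \<cdot> lift\<^sub>\<Phi> B A h) \<cdot> coit\<^sub>\<Phi> B g"
    by simp
  also have "\<dots> = MultP P (\<Phi> A) A \<cdot> (((out A \<cdot> h) \<otimes>\<^bsub>P\<^esub> lift\<^sub>\<Phi> B A h) \<cdot> (out B \<cdot> coit\<^sub>\<Phi> B g))"
    unfolding lift_spec(2)[OF assms(1,3)] by simp
  also have "\<dots> = MultP P (\<Phi> A) A \<cdot> (((out A \<cdot> h) \<otimes>\<^bsub>P\<^esub> (lift\<^sub>\<Phi> B A h \<cdot> coit\<^sub>\<Phi> B g)) \<cdot> g)"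
    unfolding coit_spec(2)[OF B assms(2)] by simp
  finally have "out A \<cdot> (lift\<^sub>\<Phi> B A h \<cdot> coit\<^sub>\<Phi> B g)
      = MultP P (\<Phi> A) A \<cdot> (((out A \<cdot> h) \<otimes>\<^bsub>P\<^esub> (lift\<^sub>\<Phi> B A h \<cdot> coit\<^sub>\<Phi> B g)) \<cdot> g)" .
  moreover have "lift\<^sub>\<Phi> B A h \<cdot> coit\<^sub>\<Phi> B g \<in> hom C X (\<Phi> A)"
    by (rule homI) auto
  ultimately show ?thesis
    using corecursion_ex1[OF assms(1-3)] assms(4,5) by metis
qed

lemma unit_simps [simp]:
  assumes "A \<in> Ob C"
  shows "unit\<^sub>\<Phi> A \<in> Ar C" "Dom C (unit\<^sub>\<Phi> A) = A" "Cod C (unit\<^sub>\<Phi> A) = \<Phi> A"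
    "out A \<cdot> unit\<^sub>\<Phi> A = UnitP P (\<Phi> A) A"
  using assms by (auto simp: nu_unit_def)

lemma out_unit_tail [simp]:
  assumes "A \<in> Ob C" "k \<in> Ar C" "Cod C k = A"
  shows "out A \<cdot> (unit\<^sub>\<Phi> A \<cdot> k) = UnitP P (\<Phi> A) A \<cdot> k"
  using assms by (simp add: nu_unit_def)

text \<open>\<open>out A\<close> is monic, so it may be applied to both sides; naturality then moves
  the unit of the parametrized monad next to \<open>MultP\<close>, which cancels it.\<close>

lemma lift_unit:
  assumes "A \<in> Ob C" "h \<in> hom C B (\<Phi> A)"
  shows "lift\<^sub>\<Phi> B A h \<cdot> unit\<^sub>\<Phi> B = h"
proof (rule out_mono[OF assms(1) _ assms(2)])
  note [simp] = assms(1) homD[OF assms(2)]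
  have [simp]: "B \<in> Ob C"
    using hom_in_Ob assms by auto
  show "lift\<^sub>\<Phi> B A h \<cdot> unit\<^sub>\<Phi> B \<in> hom C B (\<Phi> A)"
    by (rule homI) auto
  have "out A \<cdot> (lift\<^sub>\<Phi> B A h \<cdot> unit\<^sub>\<Phi> B) = (out A \<cdot> lift\<^sub>\<Phi> B A h) \<cdot> unit\<^sub>\<Phi> B"
    by simp
  also have "\<dots> = (MultP P (\<Phi> A) A \<cdot> UnitP P (\<Phi> A) (A \<sharp>\<^bsub>P\<^esub> \<Phi> A)) \<cdot> (out A \<cdot> h)"
    unfolding lift_spec(2)[OF assms] by (simp del: MultP_UnitP)
  also have "\<dots> = out A \<cdot> h"
    by simp
  finally show "out A \<cdot> (lift\<^sub>\<Phi> B A h \<cdot> unit\<^sub>\<Phi> B) = out A \<cdot> h" .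
qed

text \<open>The left side satisfies the corecursive equation that characterises the lifting on the
  right; the computation rests on naturality and associativity of \<open>MultP\<close>.\<close>

lemma lift_lift:
  assumes "A \<in> Ob C" "k \<in> hom C B (\<Phi> A)" "h \<in> hom C D (\<Phi> B)"
  shows "lift\<^sub>\<Phi> B A k \<cdot> lift\<^sub>\<Phi> D B h = lift\<^sub>\<Phi> D A (lift\<^sub>\<Phi> B A k \<cdot> h)"
proof (rule lift_eqI[symmetric, OF assms(1)])
  note [simp] = assms(1) homD[OF assms(2)] homD[OF assms(3)]
  have B [simp]: "B \<in> Ob C" and [simp]: "D \<in> Ob C"
    using hom_in_Ob assms by auto
  let ?k = "lift\<^sub>\<Phi> B A k" and ?h = "lift\<^sub>\<Phi> D B h" and ?m = "MultP P (\<Phi> A) A"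
  show "?k \<cdot> h \<in> hom C D (\<Phi> A)" "?k \<cdot> ?h \<in> hom C (\<Phi> D) (\<Phi> A)"
    by (auto intro!: homI)
  let ?r = "((out A \<cdot> k) \<otimes>\<^bsub>P\<^esub> ?k) \<cdot> (out B \<cdot> h)"
  have "out A \<cdot> (?k \<cdot> ?h) = (out A \<cdot> ?k) \<cdot> ?h"
    by simp
  also have "\<dots> = ?m \<cdot> (((out A \<cdot> k) \<otimes>\<^bsub>P\<^esub> ?k) \<cdot> (out B \<cdot> ?h))"
    unfolding lift_spec(2)[OF assms(1,2)] by simp
  also have "\<dots> = ?m \<cdot> ((((out A \<cdot> k) \<otimes>\<^bsub>P\<^esub> ?k) \<cdot> MultP P (\<Phi> B) B)
      \<cdot> (((out B \<cdot> h) \<otimes>\<^bsub>P\<^esub> ?h) \<cdot> out D))"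
    unfolding lift_spec(2)[OF B assms(3)] by (simp del: MultP_natural)
  \<comment> \<open>Naturality moves the pair past \<open>MultP P (\<Phi> B) B\<close>, leaving two
    consecutive multiplications; associativity then pushes one of them into the first
    argument.\<close>
  also have "\<dots> = (?m \<cdot> MultP P (\<Phi> A) (A \<sharp>\<^bsub>P\<^esub> \<Phi> A)) \<cdot> ((?r \<otimes>\<^bsub>P\<^esub> (?k \<cdot> ?h)) \<cdot> out D)"
    by simp
  also have "\<dots> = ?m \<cdot> (((?m \<cdot> ?r) \<otimes>\<^bsub>P\<^esub> (?k \<cdot> ?h)) \<cdot> out D)"
    by (simp add: MultP_MultP)
  \<comment> \<open>The first argument is now one unfolding of \<open>?k\<close> applied to
    \<open>h\<close>, and is folded back.\<close>
  also have "?m \<cdot> ?r = (out A \<cdot> ?k) \<cdot> h"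
    unfolding lift_spec(2)[OF assms(1,2)] by simp
  also have "\<dots> = out A \<cdot> (?k \<cdot> h)"
    by simp
  finally show "out A \<cdot> (?k \<cdot> ?h) = ?m \<cdot> (((out A \<cdot> (?k \<cdot> h)) \<otimes>\<^bsub>P\<^esub> (?k \<cdot> ?h)) \<cdot> out D)" .
qed

section \<open>Functor action and multiplication of the monad\<close>

lemma map_eq: "map\<^sub>\<Phi> g = lift\<^sub>\<Phi> (Dom C g) (Cod C g) (unit\<^sub>\<Phi> (Cod C g) \<cdot> g)"
  by (simp add: nu_monad_def)

lemma map_simps [simp]:
  assumes "g \<in> Ar C"
  shows "map\<^sub>\<Phi> g \<in> Ar C" "Dom C (map\<^sub>\<Phi> g) = \<Phi> (Dom C g)" "Cod C (map\<^sub>\<Phi> g) = \<Phi> (Cod C g)"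
  using assms Cod_in_Ob[OF assms] by (auto simp: map_eq)

lemma map_unit:
  assumes "g \<in> hom C A B"
  shows "map\<^sub>\<Phi> g \<cdot> unit\<^sub>\<Phi> A = unit\<^sub>\<Phi> B \<cdot> g"
  using lift_unit[of B "unit\<^sub>\<Phi> B \<cdot> g" A] homD[OF assms] hom_in_Ob[OF assms] by (simp add: map_eq homI)

lemma lift_map:
  assumes "D \<in> Ob C" "g \<in> hom C A B" "h \<in> hom C B (\<Phi> D)"
  shows "lift\<^sub>\<Phi> B D h \<cdot> map\<^sub>\<Phi> g = lift\<^sub>\<Phi> A D (h \<cdot> g)"
proof -
  note [simp] = assms(1) homD[OF assms(2)] homD[OF assms(3)] hom_in_Ob[OF assms(2)]
  have "lift\<^sub>\<Phi> B D h \<cdot> map\<^sub>\<Phi> g = lift\<^sub>\<Phi> A D ((lift\<^sub>\<Phi> B D h \<cdot> unit\<^sub>\<Phi> B) \<cdot> g)"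
    using lift_lift[OF assms(1,3), of "unit\<^sub>\<Phi> B \<cdot> g" A] by (simp add: map_eq homI)
  then show ?thesis
    by (simp add: lift_unit[OF assms(1,3)])
qed

text \<open>The argument of the lifting begins with a unit, so the unit law removes
  \<open>MultP\<close> from the corecursive equation.\<close>

lemma out_map:
  assumes "g \<in> hom C A B"
  shows "out B \<cdot> map\<^sub>\<Phi> g = (g \<otimes>\<^bsub>P\<^esub> map\<^sub>\<Phi> g) \<cdot> out A"
proof -
  note [simp] = homD[OF assms] hom_in_Ob[OF assms]
  have "out B \<cdot> map\<^sub>\<Phi> g = MultP P (\<Phi> B) B \<cdot> (((out B \<cdot> (unit\<^sub>\<Phi> B \<cdot> g)) \<otimes>\<^bsub>P\<^esub> map\<^sub>\<Phi> g) \<cdot> out A)"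
    using lift_spec(2)[of B "unit\<^sub>\<Phi> B \<cdot> g" A] by (simp add: map_eq homI)
  also have "\<dots> = (MultP P (\<Phi> B) B \<cdot> (UnitP P (\<Phi> B) B \<otimes>\<^bsub>P\<^esub> Id C (\<Phi> B)))
      \<cdot> ((g \<otimes>\<^bsub>P\<^esub> map\<^sub>\<Phi> g) \<cdot> out A)"
    by (simp del: MultP_TAr_UnitP)
  also have "\<dots> = (g \<otimes>\<^bsub>P\<^esub> map\<^sub>\<Phi> g) \<cdot> out A"
    by simp
  finally show ?thesis .
qed

text \<open>By \<open>out_map\<close> the left side is a coalgebra morphism from the equation with
  changed parameters. This relates renaming of parameters in an equation to the functor
  \<open>\<Phi>\<close>, both for compositionality and for morphisms of algebras.\<close>

lemma map_coit:
  assumes "g \<in> hom C A B" "e \<in> hom C X (A \<sharp>\<^bsub>P\<^esub> X)"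
  shows "map\<^sub>\<Phi> g \<cdot> coit\<^sub>\<Phi> A e = coit\<^sub>\<Phi> B ((g \<otimes>\<^bsub>P\<^esub> Id C X) \<cdot> e)"
proof (rule coit_eqI[symmetric])
  note [simp] = homD[OF assms(1)] homD[OF assms(2)]
  show [simp]: "B \<in> Ob C"
    using hom_in_Ob assms by auto
  have A [simp]: "A \<in> Ob C" and [simp]: "X \<in> Ob C"
    using hom_in_Ob assms by auto
  show "(g \<otimes>\<^bsub>P\<^esub> Id C X) \<cdot> e \<in> hom C X (B \<sharp>\<^bsub>P\<^esub> X)" "map\<^sub>\<Phi> g \<cdot> coit\<^sub>\<Phi> A e \<in> hom C X (\<Phi> B)"
    by (auto intro!: homI)
  have "out B \<cdot> (map\<^sub>\<Phi> g \<cdot> coit\<^sub>\<Phi> A e) = (out B \<cdot> map\<^sub>\<Phi> g) \<cdot> coit\<^sub>\<Phi> A e"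
    by simp
  also have "\<dots> = (g \<otimes>\<^bsub>P\<^esub> map\<^sub>\<Phi> g) \<cdot> (out A \<cdot> coit\<^sub>\<Phi> A e)"
    unfolding out_map[OF assms(1)] by simp
  also have "\<dots> = (Id C B \<otimes>\<^bsub>P\<^esub> (map\<^sub>\<Phi> g \<cdot> coit\<^sub>\<Phi> A e)) \<cdot> ((g \<otimes>\<^bsub>P\<^esub> Id C X) \<cdot> e)"
    unfolding coit_spec(2)[OF A assms(2)] by simp
  finally show "out B \<cdot> (map\<^sub>\<Phi> g \<cdot> coit\<^sub>\<Phi> A e)
      = (Id C B \<otimes>\<^bsub>P\<^esub> (map\<^sub>\<Phi> g \<cdot> coit\<^sub>\<Phi> A e)) \<cdot> ((g \<otimes>\<^bsub>P\<^esub> Id C X) \<cdot> e)" .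
qed

lemma map_Id:
  assumes "A \<in> Ob C"
  shows "map\<^sub>\<Phi> (Id C A) = Id C (\<Phi> A)"
  using map_coit[of "Id C A" A A "out A" "\<Phi> A"] assms by (simp add: homI)

lemma map_Comp:
  assumes "f \<in> hom C A B" "g \<in> hom C B D"
  shows "map\<^sub>\<Phi> (g \<cdot> f) = map\<^sub>\<Phi> g \<cdot> map\<^sub>\<Phi> f"
  using lift_map[OF _ assms(1), of D "unit\<^sub>\<Phi> D \<cdot> g"] homD[OF assms(1)] homD[OF assms(2)]
    hom_in_Ob[OF assms(2)]
  by (simp add: map_eq[of g] map_eq[of "g \<cdot> f"] homI)

lemma join_eq: "join\<^sub>\<Phi> A = lift\<^sub>\<Phi> (\<Phi> A) A (Id C (\<Phi> A))"
  by (simp add: nu_monad_def)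

lemma join_simps [simp]:
  assumes "A \<in> Ob C"
  shows "join\<^sub>\<Phi> A \<in> Ar C" "Dom C (join\<^sub>\<Phi> A) = \<Phi> (\<Phi> A)" "Cod C (join\<^sub>\<Phi> A) = \<Phi> A"
  using assms by (auto simp: join_eq)

lemma out_join:
  assumes "A \<in> Ob C"
  shows "out A \<cdot> join\<^sub>\<Phi> A = MultP P (\<Phi> A) A \<cdot> ((out A \<otimes>\<^bsub>P\<^esub> join\<^sub>\<Phi> A) \<cdot> out (\<Phi> A))"
  using lift_spec(2)[of A "Id C (\<Phi> A)" "\<Phi> A"] assms by (simp add: join_eq homI)

lemma join_unit:
  assumes "A \<in> Ob C"
  shows "join\<^sub>\<Phi> A \<cdot> unit\<^sub>\<Phi> (\<Phi> A) = Id C (\<Phi> A)"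
  using lift_unit[of A "Id C (\<Phi> A)" "\<Phi> A"] assms by (simp add: join_eq homI)

lemma join_map:
  assumes "A \<in> Ob C" "h \<in> hom C B (\<Phi> A)"
  shows "join\<^sub>\<Phi> A \<cdot> map\<^sub>\<Phi> h = lift\<^sub>\<Phi> B A h"
  using lift_map[OF assms(1,2), of "Id C (\<Phi> A)"] assms(1) homD[OF assms(2)]
  by (simp add: join_eq homI)

section \<open>Algebras\<close>

text \<open>On the left summand the copairing starts with a unit that \<open>MultP\<close> cancels,
  so the composite just runs \<open>f\<close>; on the right summand it runs \<open>g\<close> and
  continues with \<open>f\<close> in the parameters.\<close>

lemma equation_comp_simps:
  assumes "A \<in> Ob C" "f \<in> hom C Y (A \<sharp>\<^bsub>P\<^esub> Y)" "g \<in> hom C X (Y \<sharp>\<^bsub>P\<^esub> X)"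
  shows "equation_comp C P K A Y X f g \<in> hom C (Cop K Y X) (A \<sharp>\<^bsub>P\<^esub> Cop K Y X)"
    "equation_comp C P K A Y X f g \<cdot> Inl K Y X = (Id C A \<otimes>\<^bsub>P\<^esub> Inl K Y X) \<cdot> f"
    "equation_comp C P K A Y X f g \<cdot> Inr K Y X =
      MultP P (Cop K Y X) A \<cdot> ((((Id C A \<otimes>\<^bsub>P\<^esub> Inl K Y X) \<cdot> f) \<otimes>\<^bsub>P\<^esub> Inr K Y X) \<cdot> g)"
proof -
  note [simp] = assms(1) homD[OF assms(2)] homD[OF assms(3)]
  have [simp]: "X \<in> Ob C" "Y \<in> Ob C"
    using hom_in_Ob assms by auto
  let ?S = "Cop K Y X" and ?f = "(Id C A \<otimes>\<^bsub>P\<^esub> Inl K Y X) \<cdot> f"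
  show "equation_comp C P K A Y X f g \<in> hom C ?S (A \<sharp>\<^bsub>P\<^esub> ?S)"
    unfolding equation_comp_def by (rule homI) auto
  show "equation_comp C P K A Y X f g \<cdot> Inr K Y X = MultP P ?S A \<cdot> ((?f \<otimes>\<^bsub>P\<^esub> Inr K Y X) \<cdot> g)"
    unfolding equation_comp_def by simp
  have "equation_comp C P K A Y X f g \<cdot> Inl K Y X
      = (MultP P ?S A \<cdot> UnitP P ?S (A \<sharp>\<^bsub>P\<^esub> ?S)) \<cdot> ?f"
    unfolding equation_comp_def by (simp del: MultP_UnitP)
  then show "equation_comp C P K A Y X f g \<cdot> Inl K Y X = ?f"
    by simp
qed

text \<open>On the left summand the coiteration is that of \<open>f\<close>; substituting this in
  its unfolding on the right summand gives the corecursive equation required by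
  \<open>lift_coit_eqI\<close>.\<close>

lemma coit_equation_comp_Inr:
  assumes "A \<in> Ob C" "f \<in> hom C Y (A \<sharp>\<^bsub>P\<^esub> Y)" "g \<in> hom C X (Y \<sharp>\<^bsub>P\<^esub> X)"
  shows "coit\<^sub>\<Phi> A (equation_comp C P K A Y X f g) \<cdot> Inr K Y X = lift\<^sub>\<Phi> Y A (coit\<^sub>\<Phi> A f) \<cdot> coit\<^sub>\<Phi> Y g"
proof (rule lift_coit_eqI[symmetric, OF assms(1,3)])
  note [simp] = assms(1) homD[OF assms(2)] homD[OF assms(3)]
  have [simp]: "X \<in> Ob C" "Y \<in> Ob C"
    using hom_in_Ob assms by auto
  define q where "q = equation_comp C P K A Y X f g"
  note q = equation_comp_simps[OF assms, folded q_def]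
  note [simp] = homD[OF q(1)]
  let ?S = "Cop K Y X" and ?f = "(Id C A \<otimes>\<^bsub>P\<^esub> Inl K Y X) \<cdot> f" and ?c = "coit\<^sub>\<Phi> A q"
  show "coit\<^sub>\<Phi> A f \<in> hom C Y (\<Phi> A)"
    by (rule homI) auto
  show "coit\<^sub>\<Phi> A (equation_comp C P K A Y X f g) \<cdot> Inr K Y X \<in> hom C X (\<Phi> A)"
    unfolding q_def[symmetric] by (rule homI) auto
  \<comment> \<open>\<open>Inl\<close> is a coalgebra morphism from \<open>f\<close> to
    \<open>q\<close>.\<close>
  have l: "?c \<cdot> Inl K Y X = coit\<^sub>\<Phi> A f"
    by (rule coit_comp[OF assms(1,2) q(1)]) (auto intro!: homI simp: q(2))
  have "out A \<cdot> (?c \<cdot> Inr K Y X) = (out A \<cdot> ?c) \<cdot> Inr K Y X"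
    by simp
  also have "\<dots> = (Id C A \<otimes>\<^bsub>P\<^esub> ?c) \<cdot> (q \<cdot> Inr K Y X)"
    unfolding coit_spec(2)[OF assms(1) q(1)] by simp
  also have "\<dots> = ((Id C A \<otimes>\<^bsub>P\<^esub> ?c) \<cdot> MultP P ?S A) \<cdot> ((?f \<otimes>\<^bsub>P\<^esub> Inr K Y X) \<cdot> g)"
    unfolding q(3) by (simp del: MultP_natural)
  also have "\<dots> = MultP P (\<Phi> A) A \<cdot> ((((Id C A \<otimes>\<^bsub>P\<^esub> coit\<^sub>\<Phi> A f) \<cdot> f) \<otimes>\<^bsub>P\<^esub> (?c \<cdot> Inr K Y X)) \<cdot> g)"
    by (simp add: l)
  also have "(Id C A \<otimes>\<^bsub>P\<^esub> coit\<^sub>\<Phi> A f) \<cdot> f = out A \<cdot> coit\<^sub>\<Phi> A f"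
    by (rule coit_spec(2)[OF assms(1,2), symmetric])
  finally show "out A \<cdot> (coit\<^sub>\<Phi> A (equation_comp C P K A Y X f g) \<cdot> Inr K Y X)
      = MultP P (\<Phi> A) A \<cdot> (((out A \<cdot> coit\<^sub>\<Phi> A f)
          \<otimes>\<^bsub>P\<^esub> (coit\<^sub>\<Phi> A (equation_comp C P K A Y X f g) \<cdot> Inr K Y X)) \<cdot> g)"
    unfolding q_def .
qed

section \<open>From algebras of the monad to complete Elgot algebras\<close>

lemma EM_algebra_iff:
  "EM_algebra C (nu_monad C P \<Phi> out) A \<chi> \<longleftrightarrow>
    A \<in> Ob C \<and> \<chi> \<in> hom C (\<Phi> A) A \<and> \<chi> \<cdot> unit\<^sub>\<Phi> A = Id C A \<and> \<chi> \<cdot> map\<^sub>\<Phi> \<chi> = \<chi> \<cdot> join\<^sub>\<Phi> A"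
proof -
  have "FOb (MFun (nu_monad C P \<Phi> out)) = \<Phi>" "Eta (nu_monad C P \<Phi> out) = unit\<^sub>\<Phi>"
    by (simp_all add: nu_monad_def)
  then show ?thesis
    by (simp add: EM_algebra_def)
qed

text \<open>Form one layer whose continuations return immediately, and evaluate it with
  \<open>\<chi>\<close>.\<close>

abbreviation (input) "EM_op A \<chi> \<equiv> \<chi> \<cdot> (out_inv A \<cdot> (Id C A \<otimes>\<^bsub>P\<^esub> unit\<^sub>\<Phi> A))"

context
  fixes A \<chi>
  assumes EM: "EM_algebra C (nu_monad C P \<Phi> out) A \<chi>"
begin

lemma EM_simps [simp]:
  "A \<in> Ob C" "\<chi> \<in> Ar C" "Dom C \<chi> = \<Phi> A" "Cod C \<chi> = A"
  and EM_unit: "\<chi> \<cdot> unit\<^sub>\<Phi> A = Id C A"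
  and EM_join: "\<chi> \<cdot> map\<^sub>\<Phi> \<chi> = \<chi> \<cdot> join\<^sub>\<Phi> A"
  using EM by (auto simp: EM_algebra_iff hom_def)

text \<open>Any such \<open>k\<close> equals \<open>out (\<Phi> A)\<close> after
  \<open>out_inv (\<Phi> A) \<cdot> k\<close>, so the associativity law can be read on single
  layers, where \<open>map\<^sub>\<Phi> \<chi>\<close> and \<open>join\<^sub>\<Phi> A\<close> act by
  their unfolding equations.\<close>

lemma EM_out_inv:
  assumes "k \<in> hom C X (\<Phi> A \<sharp>\<^bsub>P\<^esub> \<Phi> (\<Phi> A))"
  shows "\<chi> \<cdot> (out_inv A \<cdot> ((\<chi> \<otimes>\<^bsub>P\<^esub> map\<^sub>\<Phi> \<chi>) \<cdot> k))
    = \<chi> \<cdot> (out_inv A \<cdot> (MultP P (\<Phi> A) A \<cdot> ((out A \<otimes>\<^bsub>P\<^esub> join\<^sub>\<Phi> A) \<cdot> k)))"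
proof -
  note [simp] = homD[OF assms]
  let ?k = "out_inv (\<Phi> A) \<cdot> k"
  have "\<chi> \<cdot> (out_inv A \<cdot> ((\<chi> \<otimes>\<^bsub>P\<^esub> map\<^sub>\<Phi> \<chi>) \<cdot> k))
      = \<chi> \<cdot> (out_inv A \<cdot> (((\<chi> \<otimes>\<^bsub>P\<^esub> map\<^sub>\<Phi> \<chi>) \<cdot> out (\<Phi> A)) \<cdot> ?k))"
    by simp
  also have "\<dots> = \<chi> \<cdot> (out_inv A \<cdot> ((out A \<cdot> map\<^sub>\<Phi> \<chi>) \<cdot> ?k))"
    using out_map[of \<chi> "\<Phi> A" A] by (simp add: homI)
  also have "\<dots> = (\<chi> \<cdot> map\<^sub>\<Phi> \<chi>) \<cdot> ?k"
    by simp
  also have "\<dots> = \<chi> \<cdot> (out_inv A \<cdot> ((out A \<cdot> join\<^sub>\<Phi> A) \<cdot> ?k))"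
    unfolding EM_join by simp
  also have "\<dots> = \<chi> \<cdot> (out_inv A \<cdot> (MultP P (\<Phi> A) A \<cdot> ((out A \<otimes>\<^bsub>P\<^esub> join\<^sub>\<Phi> A) \<cdot> k)))"
    unfolding out_join[OF EM_simps(1)] by simp
  finally show ?thesis .
qed

text \<open>Compare the two sides of the associativity law on \<open>unit \<otimes> unit\<close>.\<close>

lemma EM_op_TAr: "EM_op A \<chi> \<cdot> (Id C A \<otimes>\<^bsub>P\<^esub> \<chi>) = \<chi> \<cdot> out_inv A"
proof -
  let ?k = "unit\<^sub>\<Phi> A \<otimes>\<^bsub>P\<^esub> unit\<^sub>\<Phi> (\<Phi> A)"
  have "\<chi> \<cdot> (out_inv A \<cdot> ((\<chi> \<otimes>\<^bsub>P\<^esub> map\<^sub>\<Phi> \<chi>) \<cdot> ?k))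
    = \<chi> \<cdot> (out_inv A \<cdot> (MultP P (\<Phi> A) A \<cdot> ((out A \<otimes>\<^bsub>P\<^esub> join\<^sub>\<Phi> A) \<cdot> ?k)))"
    by (rule EM_out_inv[of _ "A \<sharp>\<^bsub>P\<^esub> \<Phi> A"]) (auto intro!: homI)
  \<comment> \<open>On the left, the unit law and naturality of the unit give
    \<open>Id \<otimes> (unit \<cdot> \<chi>)\<close>; on the right, \<open>join\<close> and
    \<open>MultP\<close> cancel both units.\<close>
  then show ?thesis
    using map_unit[of \<chi> "\<Phi> A" A] by (simp add: EM_unit join_unit homI)
qed

lemma EM_op_sharp_algebra: "sharp_algebra C P A (EM_op A \<chi>)"
  unfolding sharp_algebra_def
proof (intro conjI)
  show "EM_op A \<chi> \<in> hom C (A \<sharp>\<^bsub>P\<^esub> A) A"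
    by (rule homI) auto
  show "EM_op A \<chi> \<cdot> UnitP P A A = Id C A"
    using EM_unit by (simp add: nu_unit_def[of C P \<Phi> out A])
  \<comment> \<open>Associativity is tested on a layer whose parameters are themselves layers
    \<open>?i\<close> and whose continuations return twice. Facts 1 and 2 below reduce the double
    return to a single one on either side.\<close>
  let ?i = "out_inv A \<cdot> (Id C A \<otimes>\<^bsub>P\<^esub> unit\<^sub>\<Phi> A)"
  let ?k = "?i \<otimes>\<^bsub>P\<^esub> (unit\<^sub>\<Phi> (\<Phi> A) \<cdot> unit\<^sub>\<Phi> A)"
  have *: "\<chi> \<cdot> (out_inv A \<cdot> ((\<chi> \<otimes>\<^bsub>P\<^esub> map\<^sub>\<Phi> \<chi>) \<cdot> ?k))
    = \<chi> \<cdot> (out_inv A \<cdot> (MultP P (\<Phi> A) A \<cdot> ((out A \<otimes>\<^bsub>P\<^esub> join\<^sub>\<Phi> A) \<cdot> ?k)))"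
    by (rule EM_out_inv[of _ "A \<sharp>\<^bsub>P\<^esub> A \<sharp>\<^bsub>P\<^esub> A"]) (auto intro!: homI)
  have "map\<^sub>\<Phi> \<chi> \<cdot> (unit\<^sub>\<Phi> (\<Phi> A) \<cdot> unit\<^sub>\<Phi> A) = (map\<^sub>\<Phi> \<chi> \<cdot> unit\<^sub>\<Phi> (\<Phi> A)) \<cdot> unit\<^sub>\<Phi> A"
    by simp
  also have "\<dots> = unit\<^sub>\<Phi> A"
    using map_unit[of \<chi> "\<Phi> A" A] by (simp add: EM_unit homI)
  finally have 1: "map\<^sub>\<Phi> \<chi> \<cdot> (unit\<^sub>\<Phi> (\<Phi> A) \<cdot> unit\<^sub>\<Phi> A) = unit\<^sub>\<Phi> A" .
  have "join\<^sub>\<Phi> A \<cdot> (unit\<^sub>\<Phi> (\<Phi> A) \<cdot> unit\<^sub>\<Phi> A) = (join\<^sub>\<Phi> A \<cdot> unit\<^sub>\<Phi> (\<Phi> A)) \<cdot> unit\<^sub>\<Phi> A"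
    by simp
  also have "\<dots> = unit\<^sub>\<Phi> A"
    by (simp add: join_unit)
  finally have 2: "join\<^sub>\<Phi> A \<cdot> (unit\<^sub>\<Phi> (\<Phi> A) \<cdot> unit\<^sub>\<Phi> A) = unit\<^sub>\<Phi> A" .
  show "EM_op A \<chi> \<cdot> (EM_op A \<chi> \<otimes>\<^bsub>P\<^esub> Id C A) = EM_op A \<chi> \<cdot> MultP P A A"
    using * by (simp add: 1 2)
qed simp

lemma EM_coit_complete_Elgot_algebra:
  "complete_Elgot_algebra C P K A (EM_op A \<chi>) (\<lambda>e \<in> equations C P A. \<chi> \<cdot> coit\<^sub>\<Phi> A e)"
proof -
  define d where "d = (\<lambda>e \<in> equations C P A. \<chi> \<cdot> coit\<^sub>\<Phi> A e)"
  have ext: "d \<in> extensional (equations C P A)"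
    by (simp add: d_def)
  have d: "d e = \<chi> \<cdot> coit\<^sub>\<Phi> A e" if "e \<in> hom C X (A \<sharp>\<^bsub>P\<^esub> X)" for X e
    using that hom_in_Ob[OF that] by (auto simp: d_def equations_def)
  have hom: "\<chi> \<cdot> coit\<^sub>\<Phi> A e \<in> hom C X A" if "e \<in> hom C X (A \<sharp>\<^bsub>P\<^esub> X)" for X e
    using homD[OF that] by (simp add: homI)
  \<comment> \<open>Solution law: \<open>EM_op_TAr\<close> turns the operation after
    \<open>\<chi>\<close> into \<open>\<chi> \<cdot> out_inv A\<close>, and \<open>out_inv A\<close>
    cancels the layer produced by coiteration.\<close>
  have "\<chi> \<cdot> coit\<^sub>\<Phi> A e = EM_op A \<chi> \<cdot> ((Id C A \<otimes>\<^bsub>P\<^esub> (\<chi> \<cdot> coit\<^sub>\<Phi> A e)) \<cdot> e)"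
    if e: "e \<in> hom C X (A \<sharp>\<^bsub>P\<^esub> X)" for X e
  proof -
    note [simp] = homD[OF e] hom_in_Ob[OF e]
    have "EM_op A \<chi> \<cdot> ((Id C A \<otimes>\<^bsub>P\<^esub> (\<chi> \<cdot> coit\<^sub>\<Phi> A e)) \<cdot> e)
        = (EM_op A \<chi> \<cdot> (Id C A \<otimes>\<^bsub>P\<^esub> \<chi>)) \<cdot> ((Id C A \<otimes>\<^bsub>P\<^esub> coit\<^sub>\<Phi> A e) \<cdot> e)"
      by simp
    also have "\<dots> = (\<chi> \<cdot> out_inv A) \<cdot> (out A \<cdot> coit\<^sub>\<Phi> A e)"
      unfolding EM_op_TAr coit_spec(2)[OF EM_simps(1) e] ..
    also have "\<dots> = \<chi> \<cdot> coit\<^sub>\<Phi> A e"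
      by simp
    finally show ?thesis ..
  qed
  moreover have "(\<chi> \<cdot> coit\<^sub>\<Phi> A f) \<cdot> h = \<chi> \<cdot> coit\<^sub>\<Phi> A e"
    if "e \<in> hom C X (A \<sharp>\<^bsub>P\<^esub> X)" "f \<in> hom C Y (A \<sharp>\<^bsub>P\<^esub> Y)" "h \<in> hom C X Y"
      "f \<cdot> h = (Id C A \<otimes>\<^bsub>P\<^esub> h) \<cdot> e" for X Y e f h
    using coit_comp[OF EM_simps(1) that] homD[OF that(2)] homD[OF that(3)] by simp
  \<comment> \<open>Compositionality: the parameter change becomes \<open>map\<^sub>\<Phi>\<close>,
    associativity of \<open>\<chi>\<close> replaces \<open>map\<^sub>\<Phi> \<chi>\<close> by
    \<open>join\<^sub>\<Phi> A\<close>, and \<open>join_map\<close> produces the lifting that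
    coiterates the composed equation.\<close>
  moreover have "(\<chi> \<cdot> coit\<^sub>\<Phi> A (equation_comp C P K A Y X f g)) \<cdot> Inr K Y X
      = \<chi> \<cdot> coit\<^sub>\<Phi> A (((\<chi> \<cdot> coit\<^sub>\<Phi> A f) \<otimes>\<^bsub>P\<^esub> Id C X) \<cdot> g)"
    if f: "f \<in> hom C Y (A \<sharp>\<^bsub>P\<^esub> Y)" and g: "g \<in> hom C X (Y \<sharp>\<^bsub>P\<^esub> X)" for X Y f g
  proof -
    note [simp] = homD[OF f] homD[OF g] hom_in_Ob(1)[OF f] hom_in_Ob(1)[OF g]
      homD[OF equation_comp_simps(1)[OF EM_simps(1) f g]]
    have cf: "coit\<^sub>\<Phi> A f \<in> hom C Y (\<Phi> A)"
      by (simp add: homI)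
    have "\<chi> \<cdot> coit\<^sub>\<Phi> A (((\<chi> \<cdot> coit\<^sub>\<Phi> A f) \<otimes>\<^bsub>P\<^esub> Id C X) \<cdot> g)
        = \<chi> \<cdot> (map\<^sub>\<Phi> (\<chi> \<cdot> coit\<^sub>\<Phi> A f) \<cdot> coit\<^sub>\<Phi> Y g)"
      using map_coit[OF hom[OF f] g] by simp
    also have "\<dots> = (\<chi> \<cdot> map\<^sub>\<Phi> \<chi>) \<cdot> (map\<^sub>\<Phi> (coit\<^sub>\<Phi> A f) \<cdot> coit\<^sub>\<Phi> Y g)"
      using map_Comp[OF cf, of \<chi> A] by (simp add: homI)
    also have "\<dots> = \<chi> \<cdot> ((join\<^sub>\<Phi> A \<cdot> map\<^sub>\<Phi> (coit\<^sub>\<Phi> A f)) \<cdot> coit\<^sub>\<Phi> Y g)"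
      unfolding EM_join by simp
    also have "\<dots> = (\<chi> \<cdot> coit\<^sub>\<Phi> A (equation_comp C P K A Y X f g)) \<cdot> Inr K Y X"
      unfolding join_map[OF EM_simps(1) cf]
      using coit_equation_comp_Inr[OF EM_simps(1) f g] by simp
    finally show ?thesis ..
  qed
  \<comment> \<open>The outer \<open>d\<close> unfolds only once its argument is known to be an
    equation over \<open>A\<close>.\<close>
  moreover have "d (((\<chi> \<cdot> coit\<^sub>\<Phi> A f) \<otimes>\<^bsub>P\<^esub> Id C X) \<cdot> g)
      = \<chi> \<cdot> coit\<^sub>\<Phi> A (((\<chi> \<cdot> coit\<^sub>\<Phi> A f) \<otimes>\<^bsub>P\<^esub> Id C X) \<cdot> g)"
    if f: "f \<in> hom C Y (A \<sharp>\<^bsub>P\<^esub> Y)" and g: "g \<in> hom C X (Y \<sharp>\<^bsub>P\<^esub> X)" for X Y f g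
    by (rule d[of _ X])
      (use homD[OF hom[OF f]] homD[OF g] hom_in_Ob(1)[OF g] in \<open>simp add: homI\<close>)
  ultimately have "complete_Elgot_algebra C P K A (EM_op A \<chi>) d"
    unfolding complete_Elgot_algebra_def
    using EM_op_sharp_algebra ext hom
    by (simp add: d d[OF equation_comp_simps(1)[OF EM_simps(1)]] del: Comp_assoc_Ar)
  then show ?thesis
    unfolding d_def .
qed

end

section \<open>From complete Elgot algebras to algebras of the monad\<close>

lemma complete_Elgot_algebraD:
  assumes "complete_Elgot_algebra C P K A a d"
  shows "A \<in> Ob C" "a \<in> hom C (A \<sharp>\<^bsub>P\<^esub> A) A" "a \<cdot> UnitP P A A = Id C A"
    and "d \<in> extensional (equations C P A)"
    and "e \<in> hom C X (A \<sharp>\<^bsub>P\<^esub> X) \<Longrightarrow> d e \<in> hom C X A"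
    and "e \<in> hom C X (A \<sharp>\<^bsub>P\<^esub> X) \<Longrightarrow> d e = a \<cdot> ((Id C A \<otimes>\<^bsub>P\<^esub> d e) \<cdot> e)"
    and "\<lbrakk>e \<in> hom C X (A \<sharp>\<^bsub>P\<^esub> X); f \<in> hom C Y (A \<sharp>\<^bsub>P\<^esub> Y); h \<in> hom C X Y;
      f \<cdot> h = (Id C A \<otimes>\<^bsub>P\<^esub> h) \<cdot> e\<rbrakk> \<Longrightarrow> d f \<cdot> h = d e"
    and "\<lbrakk>f \<in> hom C Y (A \<sharp>\<^bsub>P\<^esub> Y); g \<in> hom C X (Y \<sharp>\<^bsub>P\<^esub> X)\<rbrakk>
      \<Longrightarrow> d (equation_comp C P K A Y X f g) \<cdot> Inr K Y X = d ((d f \<otimes>\<^bsub>P\<^esub> Id C X) \<cdot> g)"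
  using assms unfolding complete_Elgot_algebra_def sharp_algebra_def
  by (blast dest: hom_in_Ob)+

context
  fixes A a d
  assumes CElg: "complete_Elgot_algebra C P K A a d"
begin

lemma CElg_simps [simp]:
  "A \<in> Ob C" "a \<in> Ar C" "Dom C a = A \<sharp>\<^bsub>P\<^esub> A" "Cod C a = A"
  "d (out A) \<in> Ar C" "Dom C (d (out A)) = \<Phi> A" "Cod C (d (out A)) = A"
  using complete_Elgot_algebraD(1,2)[OF CElg] complete_Elgot_algebraD(5)[OF CElg, of "out A" "\<Phi> A"]
  by (auto simp: hom_def)

text \<open>\<open>coit\<^sub>\<Phi> A e\<close> is a coalgebra morphism from \<open>e\<close> to
  \<open>out A\<close>, so functoriality applies to it.\<close>

lemma CElg_dagger_eq:
  assumes "e \<in> hom C X (A \<sharp>\<^bsub>P\<^esub> X)"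
  shows "d e = d (out A) \<cdot> coit\<^sub>\<Phi> A e"
  by (rule complete_Elgot_algebraD(7)[OF CElg assms, symmetric, where Y = "\<Phi> A"])
    (use coit_spec[OF CElg_simps(1) assms] in \<open>auto intro!: homI\<close>)

lemma CElg_dagger_out: "d (out A) = a \<cdot> ((Id C A \<otimes>\<^bsub>P\<^esub> d (out A)) \<cdot> out A)"
  by (rule complete_Elgot_algebraD(6)[OF CElg]) (auto intro!: homI)

text \<open>One unfolding by the solution law exposes
  \<open>out A \<cdot> unit\<^sub>\<Phi> A\<close>, which is a unit of the parametrized monad;
  naturality and the unit law of \<open>a\<close> finish.\<close>

lemma CElg_dagger_out_unit: "d (out A) \<cdot> unit\<^sub>\<Phi> A = Id C A"
proof -
  have "d (out A) \<cdot> unit\<^sub>\<Phi> A = (a \<cdot> ((Id C A \<otimes>\<^bsub>P\<^esub> d (out A)) \<cdot> out A)) \<cdot> unit\<^sub>\<Phi> A"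
    using CElg_dagger_out by simp
  then show ?thesis
    using complete_Elgot_algebraD(3)[OF CElg] by simp
qed

text \<open>Compositionality is taken at the final equations \<open>out A\<close> and
  \<open>out (\<Phi> A)\<close>. Their coiterations are identities, so the composed equation yields
  \<open>join\<^sub>\<Phi> A\<close>, while the parameter change yields
  \<open>map\<^sub>\<Phi>\<close> of the structure map.\<close>

lemma CElg_dagger_out_EM_algebra: "EM_algebra C (nu_monad C P \<Phi> out) A (d (out A))"
proof -
  let ?\<chi> = "d (out A)"
  let ?q = "equation_comp C P K A (\<Phi> A) (\<Phi> (\<Phi> A)) (out A) (out (\<Phi> A))"
  have o: "out A \<in> hom C (\<Phi> A) (A \<sharp>\<^bsub>P\<^esub> \<Phi> A)" "out (\<Phi> A) \<in> hom C (\<Phi> (\<Phi> A)) (\<Phi> A \<sharp>\<^bsub>P\<^esub> \<Phi> (\<Phi> A))"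
    and \<chi>: "?\<chi> \<in> hom C (\<Phi> A) A"
    by (auto intro!: homI)
  note q = equation_comp_simps(1)[OF CElg_simps(1) o]
  note [simp] = homD[OF q]
  have "?\<chi> \<cdot> map\<^sub>\<Phi> ?\<chi> = ?\<chi> \<cdot> coit\<^sub>\<Phi> A ((?\<chi> \<otimes>\<^bsub>P\<^esub> Id C (\<Phi> (\<Phi> A))) \<cdot> out (\<Phi> A))"
    using map_coit[OF \<chi> o(2)] by simp
  also have "\<dots> = d ((?\<chi> \<otimes>\<^bsub>P\<^esub> Id C (\<Phi> (\<Phi> A))) \<cdot> out (\<Phi> A))"
    by (rule CElg_dagger_eq[symmetric, of _ "\<Phi> (\<Phi> A)"]) (auto intro!: homI)
  also have "\<dots> = d ?q \<cdot> Inr K (\<Phi> A) (\<Phi> (\<Phi> A))"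
    by (rule complete_Elgot_algebraD(8)[OF CElg o, symmetric])
  also have "\<dots> = ?\<chi> \<cdot> (coit\<^sub>\<Phi> A ?q \<cdot> Inr K (\<Phi> A) (\<Phi> (\<Phi> A)))"
    unfolding CElg_dagger_eq[OF q] by simp
  also have "\<dots> = ?\<chi> \<cdot> join\<^sub>\<Phi> A"
    unfolding coit_equation_comp_Inr[OF CElg_simps(1) o] by (simp add: join_eq)
  finally show ?thesis
    using \<chi> by (simp add: EM_algebra_iff CElg_dagger_out_unit)
qed

text \<open>After one unfolding by the solution law, \<open>out A\<close> meets
  \<open>out_inv A\<close>, and the remaining unit is absorbed by
  \<open>CElg_dagger_out_unit\<close>.\<close>

lemma EM_op_CElg_dagger_out: "EM_op A (d (out A)) = a"
proof -
  have "EM_op A (d (out A))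
      = (a \<cdot> ((Id C A \<otimes>\<^bsub>P\<^esub> d (out A)) \<cdot> out A)) \<cdot> (out_inv A \<cdot> (Id C A \<otimes>\<^bsub>P\<^esub> unit\<^sub>\<Phi> A))"
    using CElg_dagger_out by simp
  also have "\<dots> = a"
    by (simp add: CElg_dagger_out_unit)
  finally show ?thesis .
qed

text \<open>On equations this is \<open>CElg_dagger_eq\<close>; elsewhere both operators are
  \<open>undefined\<close>.\<close>

lemma CElg_dagger_eq_restrict: "(\<lambda>e \<in> equations C P A. d (out A) \<cdot> coit\<^sub>\<Phi> A e) = d"
proof
  fix e
  show "(\<lambda>e \<in> equations C P A. d (out A) \<cdot> coit\<^sub>\<Phi> A e) e = d e"
    using complete_Elgot_algebraD(4)[OF CElg] CElg_dagger_eq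
    by (cases "e \<in> equations C P A") (auto simp: equations_def extensional_def)
qed

end

section \<open>The two categories, their morphisms and the isomorphism\<close>

lemma category_EM: "category (EM_category C (nu_monad C P \<Phi> out))"
  unfolding EM_category_def
proof (rule category_structured_category, goal_cases)
  case (1 x)
  then show ?case
    by (auto simp: EM_algebra_def)
next
  case (2 x)
  obtain A \<chi> where x: "x = (A, \<chi>)"
    by (metis surj_pair)
  then have "EM_algebra C (nu_monad C P \<Phi> out) A \<chi>"
    using 2 by simp
  note [simp] = EM_simps[OF this]
  show ?case
    by (simp add: x map_Id)
next
  case (3 x y z f g)
  obtain A \<chi> B \<xi> D \<zeta> where xyz: "x = (A, \<chi>)" "y = (B, \<xi>)" "z = (D, \<zeta>)"
    by (metis surj_pair)
  have A: "EM_algebra C (nu_monad C P \<Phi> out) A \<chi>" and B: "EM_algebra C (nu_monad C P \<Phi> out) B \<xi>"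
    and D: "EM_algebra C (nu_monad C P \<Phi> out) D \<zeta>"
    using 3(1-3) by (auto simp: xyz)
  have f: "f \<in> hom C A B" and g: "g \<in> hom C B D"
    using 3(4,5) by (auto simp: xyz)
  note [simp] = EM_simps[OF A] EM_simps[OF B] EM_simps[OF D] homD[OF f] homD[OF g]
  have "(g \<cdot> f) \<cdot> \<chi> = g \<cdot> (\<xi> \<cdot> map\<^sub>\<Phi> f)"
    using 3(6) by (simp add: xyz)
  also have "\<dots> = (g \<cdot> \<xi>) \<cdot> map\<^sub>\<Phi> f"
    by simp
  also have "\<dots> = \<zeta> \<cdot> map\<^sub>\<Phi> (g \<cdot> f)"
    using 3(7) by (simp add: xyz map_Comp[OF f g])
  finally show ?case
    by (simp add: xyz)
qed

lemma category_CElg: "category (CElg_category C P K)"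
  unfolding CElg_category_def
proof (rule category_structured_category, goal_cases)
  case (1 x)
  then show ?case
    using complete_Elgot_algebraD(1) by auto
next
  case (2 x)
  obtain A a d where x: "x = (A, a, d)"
    by (metis surj_pair)
  then have A: "complete_Elgot_algebra C P K A a d"
    using 2 by simp
  have "d ((Id C A \<otimes>\<^bsub>P\<^esub> Id C X) \<cdot> e) = Id C A \<cdot> d e" if "e \<in> hom C X (A \<sharp>\<^bsub>P\<^esub> X)" for X e
    using homD[OF that] hom_in_Ob[OF that] complete_Elgot_algebraD(1)[OF A]
      homD[OF complete_Elgot_algebraD(5)[OF A that]] by simp
  then show ?case
    by (simp add: x)
next
  case (3 x y z f g)
  obtain A a d B b d' D c d'' where xyz: "x = (A, a, d)" "y = (B, b, d')" "z = (D, c, d'')"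
    by (metis surj_pair)
  have f: "f \<in> hom C A B" and g: "g \<in> hom C B D" and A: "complete_Elgot_algebra C P K A a d"
    using 3(1-5) by (auto simp: xyz)
  have "d'' (((g \<cdot> f) \<otimes>\<^bsub>P\<^esub> Id C X) \<cdot> e) = (g \<cdot> f) \<cdot> d e" if e: "e \<in> hom C X (A \<sharp>\<^bsub>P\<^esub> X)" for X e
  proof -
    note [simp] = homD[OF f] homD[OF g] homD[OF e] hom_in_Ob(1)[OF e]
      homD[OF complete_Elgot_algebraD(5)[OF A e]]
    let ?e = "(f \<otimes>\<^bsub>P\<^esub> Id C X) \<cdot> e"
    have "?e \<in> hom C X (B \<sharp>\<^bsub>P\<^esub> X)"
      by (rule homI) auto
    then have "d'' ((g \<otimes>\<^bsub>P\<^esub> Id C X) \<cdot> ?e) = g \<cdot> d' ?e"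
      using 3(7) by (simp add: xyz del: TAr_Comp_tail)
    also have "d' ?e = f \<cdot> d e"
      using 3(6) e by (simp add: xyz)
    finally show ?thesis
      by simp
  qed
  then show ?case
    by (simp add: xyz)
qed

lemma EM_morphism_CElg_morphism:
  assumes "EM_algebra C (nu_monad C P \<Phi> out) A \<chi>" "EM_algebra C (nu_monad C P \<Phi> out) B \<xi>"
    and f: "f \<in> hom C A B" "f \<cdot> \<chi> = \<xi> \<cdot> map\<^sub>\<Phi> f"
    and e: "e \<in> hom C X (A \<sharp>\<^bsub>P\<^esub> X)"
  shows "\<xi> \<cdot> coit\<^sub>\<Phi> B ((f \<otimes>\<^bsub>P\<^esub> Id C X) \<cdot> e) = f \<cdot> (\<chi> \<cdot> coit\<^sub>\<Phi> A e)"
proof -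
  note [simp] = EM_simps[OF assms(1)] EM_simps[OF assms(2)] homD[OF f(1)] homD[OF e]
  have "\<xi> \<cdot> coit\<^sub>\<Phi> B ((f \<otimes>\<^bsub>P\<^esub> Id C X) \<cdot> e) = (\<xi> \<cdot> map\<^sub>\<Phi> f) \<cdot> coit\<^sub>\<Phi> A e"
    by (simp add: map_coit[OF f(1) e, symmetric])
  also have "\<dots> = f \<cdot> (\<chi> \<cdot> coit\<^sub>\<Phi> A e)"
    by (simp add: f(2)[symmetric])
  finally show ?thesis .
qed

text \<open>Preservation of iteration is applied at \<open>out A\<close>; the resulting equation
  over \<open>B\<close> coiterates to \<open>map\<^sub>\<Phi> f\<close> by
  \<open>map_coit\<close>.\<close>

lemma CElg_morphism_EM_morphism:
  assumes A: "complete_Elgot_algebra C P K A a d" and B: "complete_Elgot_algebra C P K B b d'"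
    and f: "f \<in> hom C A B"
    and d: "\<And>X e. e \<in> hom C X (A \<sharp>\<^bsub>P\<^esub> X) \<Longrightarrow> d' ((f \<otimes>\<^bsub>P\<^esub> Id C X) \<cdot> e) = f \<cdot> d e"
  shows "f \<cdot> d (out A) = d' (out B) \<cdot> map\<^sub>\<Phi> f"
proof -
  note [simp] = CElg_simps[OF A] CElg_simps[OF B] homD[OF f]
  have o: "out A \<in> hom C (\<Phi> A) (A \<sharp>\<^bsub>P\<^esub> \<Phi> A)"
    by (rule homI) auto
  let ?e = "(f \<otimes>\<^bsub>P\<^esub> Id C (\<Phi> A)) \<cdot> out A"
  have "f \<cdot> d (out A) = d' ?e"
    using d[OF o] ..
  also have "\<dots> = d' (out B) \<cdot> coit\<^sub>\<Phi> B ?e"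
    by (rule CElg_dagger_eq[OF B, of _ "\<Phi> A"]) (auto intro!: homI)
  also have "\<dots> = d' (out B) \<cdot> map\<^sub>\<Phi> f"
    using map_coit[OF f o] by simp
  finally show ?thesis .
qed

lemma inverse_functors_EM_CElg:
  "inverse_functors (EM_category C (nu_monad C P \<Phi> out)) (CElg_category C P K)
    (over_identity (EM_to_CElg_ob C P \<Phi> out)) (over_identity (CElg_to_EM_ob out))"
  unfolding EM_category_def CElg_category_def
\<comment> \<open>Cases 1 and 2 are the categories, 3 and 4 the object maps, 5 and 6 preservation of
  morphisms, 7 and 8 the two round trips.\<close>
proof (rule inverse_functors_over_identity, goal_cases)
  case 1
  show ?case
    using category_EM by (simp only: EM_category_def)
next
  case 2
  show ?case
    using category_CElg by (simp only: CElg_category_def)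
next
  case (3 x)
  then show ?case
    using EM_coit_complete_Elgot_algebra by (auto simp: EM_to_CElg_ob_def)
next
  case (4 y)
  then show ?case
    using CElg_dagger_out_EM_algebra by (auto simp: CElg_to_EM_ob_def)
next
  case (5 x y f)
  obtain A \<chi> B \<xi> where xy: "x = (A, \<chi>)" "y = (B, \<xi>)"
    by (metis surj_pair)
  have A: "EM_algebra C (nu_monad C P \<Phi> out) A \<chi>" and B: "EM_algebra C (nu_monad C P \<Phi> out) B \<xi>"
    and f: "f \<in> hom C A B" "f \<cdot> \<chi> = \<xi> \<cdot> map\<^sub>\<Phi> f"
    using 5 by (auto simp: xy)
  \<comment> \<open>Both operators are restricted to equations, so membership of \<open>e\<close>
    and of its image is what lets them be evaluated.\<close>
  have e: "e \<in> equations C P A" "(f \<otimes>\<^bsub>P\<^esub> Id C X) \<cdot> e \<in> equations C P B"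
    if "e \<in> hom C X (A \<sharp>\<^bsub>P\<^esub> X)" for X e
    using that homD[OF that] hom_in_Ob(1)[OF that] homD[OF f(1)]
    by (auto simp: equations_def intro!: bexI[of _ X] homI)
  show ?case
    using EM_morphism_CElg_morphism[OF A B f] by (simp add: xy EM_to_CElg_ob_def e)
next
  case (6 x y f)
  obtain A a d B b d' where xy: "x = (A, a, d)" "y = (B, b, d')"
    by (metis surj_pair)
  show ?case
    using CElg_morphism_EM_morphism[of A a d B b d' f] 6
    by (auto simp: xy CElg_to_EM_ob_def dest: hom_in_Ob)
next
  case (7 x)
  obtain A \<chi> where x: "x = (A, \<chi>)" and A: "EM_algebra C (nu_monad C P \<Phi> out) A \<chi>"
    using 7 by auto
  note [simp] = EM_simps[OF A]
  \<comment> \<open>The restricted operator can thus be evaluated at \<open>out A\<close>, where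
    coiteration is the identity and \<open>\<chi>\<close> is recovered.\<close>
  have "out A \<in> equations C P A"
    unfolding equations_def by (intro UN_I[of "\<Phi> A"] homI) auto
  then show ?case
    by (simp add: x EM_to_CElg_ob_def CElg_to_EM_ob_def)
next
  case (8 y)
  then show ?case
    using EM_op_CElg_dagger_out CElg_dagger_eq_restrict
    by (auto simp: EM_to_CElg_ob_def CElg_to_EM_ob_def)
qed

end

theorem theorem4p21:
  fixes C :: "('o, 'm) precat"
    and P :: "('o, 'm) pmonad_data"
    and K :: "('o, 'm) coproduct_data"
    and \<Phi> :: "'o \<Rightarrow> 'o"
    and out :: "'o \<Rightarrow> 'm"
  assumes "category C"
    and "finite_coproducts C K"
    and "parametrized_monad C P"
    and "\<And>X. X \<in> Ob C \<Longrightarrow> final_coalgebra C (functor_at C P X) (\<Phi> X) (out X)"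
  shows "inverse_functors
           (EM_category C (nu_monad C P \<Phi> out))
           (CElg_category C P K)
           (over_identity (EM_to_CElg_ob C P \<Phi> out))
           (over_identity (CElg_to_EM_ob out))"
proof -
  interpret finite_coproducts C K by fact
  interpret parametrized_monad C P by fact
  interpret final_coalgebras C K P \<Phi> out
    by unfold_locales fact
  show ?thesis
    by (rule inverse_functors_EM_CElg)
qed

end
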